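(* Let $f$ be meromorphic in $\mathbb{D}$ with a direct tract $U$, a component of $\{z\in\mathbb{D}: |f(z)|>R\}$, and let $v$, $B(r)$, $a(r)$, $r_0$, $\beta$, $\delta$ be as in the context. For $r_0\le r<1$ set $$\varepsilon(r)=\min\left\{\frac{1-r}{2\,a(r)^{\beta}(\log a(r))^{1+\delta}},\ \frac{1}{a(r)^{1-\beta}(\log a(r))^{1+\delta}}\right\}.$$ Then there exists a set $E\subseteq[r_0,1)$ satisfying $\int_E \frac{dt}{1-t}<\infty$ such that, as $r\to1-$ with $r\notin E$, if $z_r$ is chosen with $|z_r|=r$ and $v(z_r)=B(r)$, then $$f(z)\sim f(z_r)\left(\frac{z}{z_r}\right)^{a(r)}=f(z_r)\exp\left(a(r)\log\frac{z}{z_r}\right)\quad\text{and}\quad \frac{f'(z)}{f(z)}\sim\frac{a(r)}{z}$$ for $|z-z_r|<\varepsilon(r)/2048$. Here the logarithm is chosen so as to vanish at $z=z_r$.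
   Context: $\mathbb{D}=\{z\in\mathbb{C}:|z|<1\}$. For $f$ meromorphic in $\mathbb{D}$, a direct tract of $f$ is a component $U$ of the set $\{z\in\mathbb{D}:|f(z)|>R\}$, for some $R\in(0,\infty)$, such that $U$ contains no poles of $f$ but $f$ is unbounded on $U$. Given such $U$ and $R$, define $v(z)=\log|f(z)/R|$ for $z\in U$ and $v(z)=0$ for $z\in\mathbb{D}\setminus U$; $v$ is continuous, subharmonic and unbounded on $\mathbb{D}$. For $0<r<1$ let $B(r)=B(r,v)=\max\{v(z):|z|=r\}$ and $a(r)=rB'(r)=\frac{dB(r)}{d\log r}$. Here $B$ is a non-decreasing convex function of $\log r$, and $a(r)$ is taken to be the right derivative with respect to $\log r$ at the (countably many) points where $B$ is not differentiable; $a$ is non-decreasing and tends to $\infty$ as $r\to1-$. The constants $r_0\in(0,1)$, $\beta$, $\delta$ are chosen with $B(r)\ge2$ and $a(r)\ge2$ for $r_0\le r<1$, $0<\beta\le\frac12$, and $\delta>0$. The asymptotic relations $X\sim Y$ mean $X/Y\to1$ as $r\to1-$ with $r\notin E$, uniformly over the stated $z$ and over the admissible choices of $z_r$. *)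

theory Defs
  imports "HOL-Complex_Analysis.Complex_Analysis"
begin

text \<open>
  A function that is \<^const>\<open>nicely_meromorphic_on\<close> a set takes the value 0 at its poles, whereas
  mathematically \<open>|f| = \<infinity> > R\<close> there. The poles are therefore added to the superlevel set
  explicitly; otherwise a component around poles, with these removed, would count as a tract.
\<close>
definition direct_tract :: "(complex \<Rightarrow> complex) \<Rightarrow> real \<Rightarrow> complex set \<Rightarrow> bool" where
  "direct_tract f R U \<longleftrightarrow>
     0 < R \<and>
     U \<in> components {z \<in> ball 0 1. is_pole f z \<or> R < cmod (f z)} \<and>
     (\<forall>z\<in>U. \<not> is_pole f z) \<and>
     \<not> bounded (f ` U)"

definition tract_fun :: "(complex \<Rightarrow> complex) \<Rightarrow> real \<Rightarrow> complex set \<Rightarrow> complex \<Rightarrow> real" where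
  "tract_fun f R U z = (if z \<in> U then ln (cmod (f z / of_real R)) else 0)"

text \<open>
  For \<open>0 < r < 1\<close> and \<open>v\<close> continuous on the unit disc this supremum is a maximum.
\<close>
definition circle_max :: "(complex \<Rightarrow> real) \<Rightarrow> real \<Rightarrow> real" where
  "circle_max v r = (SUP z \<in> sphere 0 r. v z)"

text \<open>
  The right derivative of \<open>B(r)\<close> with respect to \<open>log r\<close>. It exists for every \<open>0 < r < 1\<close> when
  \<open>B\<close> is a convex function of \<open>log r\<close>, and equals \<open>r B'(r)\<close> wherever \<open>B\<close> is differentiable.
\<close>
definition log_slope :: "(complex \<Rightarrow> real) \<Rightarrow> real \<Rightarrow> real" where
  "log_slope v r = vector_derivative (\<lambda>t. circle_max v (exp t)) (at_right (ln r))"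

definition tract_eps :: "(complex \<Rightarrow> real) \<Rightarrow> real \<Rightarrow> real \<Rightarrow> real \<Rightarrow> real" where
  "tract_eps v \<beta> \<delta> r =
     min ((1 - r) / (2 * log_slope v r powr \<beta> * ln (log_slope v r) powr (1 + \<delta>)))
         (1 / (log_slope v r powr (1 - \<beta>) * ln (log_slope v r) powr (1 + \<delta>)))"

text \<open>
  \<open>X r p \<sim> Y r p\<close>, i.e. \<open>X r p / Y r p \<rightarrow> 1\<close>, along the filter \<open>F\<close> of parameters \<open>r\<close>, uniformly
  over \<open>p \<in> S r\<close>. Since \<open>x / 0 = 0\<close>, this forces \<open>Y r p \<noteq> 0\<close> for all \<open>p \<in> S r\<close>, eventually.
\<close>
definition uniformly_asymp_equiv ::
  "real filter \<Rightarrow> (real \<Rightarrow> 'p set) \<Rightarrow> (real \<Rightarrow> 'p \<Rightarrow> complex) \<Rightarrow> (real \<Rightarrow> 'p \<Rightarrow> complex) \<Rightarrow> bool" where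
  "uniformly_asymp_equiv F S X Y \<longleftrightarrow>
     (\<forall>\<eta>>0. \<forall>\<^sub>F r in F. \<forall>p \<in> S r. cmod (X r p / Y r p - 1) < \<eta>)"

text \<open>Here \<open>w\<close> ranges over all possible choices of \<open>z\<^sub>r\<close>.\<close>
definition admissible_pairs ::
  "(complex \<Rightarrow> real) \<Rightarrow> real \<Rightarrow> real \<Rightarrow> real \<Rightarrow> (complex \<times> complex) set" where
  "admissible_pairs v \<beta> \<delta> r =
     {(w, z). cmod w = r \<and> v w = circle_max v r \<and> cmod (z - w) < tract_eps v \<beta> \<delta> r / 2048}"

end

theory Submission
  imports Defs "HOL-Real_Asymp.Real_Asymp"
begin

text \<open>
  Fix \<open>w = z\<^sub>r\<close> and put \<open>h(z) = B(r) + a(r) log |z/w|\<close>, which is harmonic near \<open>w\<close>, agrees with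
  \<open>v\<close> at \<open>w\<close>, and as a function of \<open>log |z|\<close> is a tangent to the convex function \<open>B\<close> at \<open>r\<close>. If \<open>a\<close> varies by at most
  \<open>D\<close> on an interval about \<open>r\<close> of length comparable with \<open>\<epsilon>(r)\<close>, then convexity bounds the excess
  \<open>v - h\<close> on the disc of that radius about \<open>w\<close> by a multiple \<open>\<eta>\<close> of \<open>D \<epsilon>(r)\<close>. If moreover a smaller
  disc lies in \<open>U\<close>, then there \<open>v - h\<close> is the real part of the holomorphic function
  \<open>g(z) = log (f(z)/f(w)) - a(r) log (z/w)\<close>, which vanishes at \<open>w\<close> and has \<open>Re g \<le> \<eta>\<close>. The theorem
  of Borel and Caratheodory gives \<open>|g| = O(\<eta>)\<close>, Cauchy's inequality gives \<open>|g'| = O(\<eta> / \<epsilon>(r))\<close>, and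
  the two asymptotic relations follow from \<open>\<eta> \<rightarrow> 0\<close> and \<open>\<eta> / (\<epsilon>(r) a(r)) \<rightarrow> 0\<close>.

  The exceptional set makes \<open>D = O(a(r) powr (1 - \<beta>))\<close>: cut \<open>[r\<^sub>0, 1)\<close> where \<open>a powr \<beta>\<close> passes an integer
  \<open>n\<close>, and delete around each cut an interval of logarithmic length about \<open>1 / (n (log n) powr (1 + \<delta>))\<close>.
  These lengths are summable, and if \<open>r\<close> is close to 1 and outside the deleted intervals, \<open>a powr \<beta>\<close> stays between two
  consecutive integers within distance \<open>16 \<epsilon>(r)\<close> of \<open>r\<close>
  (\<open>slow_growth_outside_exceptional_set\<close>). The two terms in the definition of \<open>\<epsilon>\<close> are what the deleted length
  and the relation \<open>\<eta> \<rightarrow> 0\<close> require.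

  It remains to see that a disc about \<open>w\<close> lies in \<open>U\<close> (\<open>positive_on_disc_of_small_excess\<close>). The danger is
  that \<open>v\<close> drops to 0 on a small set near \<open>w\<close>, for instance around a zero of \<open>f\<close>. Rescale so that the
  disc has radius 9, with \<open>h \<ge> 36\<close> there, and consider the circles about \<open>w\<close> of radius between 1 and 2.

  If one of these circles lies in \<open>U\<close>, then the mean of \<open>v\<close> over concentric circles is a convex function
  of the logarithm of the radius whose slope at that circle is a winding number of \<open>f\<close>, hence an integer.
  The bound \<open>\<eta> < 1\<close> on the growth of the mean forces this integer to be nonpositive. Moving the centre to
  a point inside the circle by a disc automorphism does not change the winding number, and now a nonpositive
  slope bounds the value of \<open>v\<close> at the new centre from below by its mean over the circle, which is positive
  (\<open>positive_inside_isolating_circle\<close>).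

  If every such circle leaves \<open>U\<close>, then the nonnegative superharmonic function \<open>h + \<eta> - v\<close> is at least 36
  somewhere on each of them. Comparison with a sum of logarithmic potentials of points on these circles
  shows that its value at the centre is at least 1, whereas this value is \<open>\<eta> < 1\<close>
  (\<open>superharmonic_lower_bound_at_center\<close>). That \<open>h\<close> is large follows from convexity once more:
  \<open>B(r)\<close> exceeds \<open>B(r - 16 \<epsilon>(r))\<close> by at least as much as \<open>h\<close> can drop on the disc.
\<close>

section \<open>Functions supported from below by harmonic functions\<close>

text \<open>
  A form of subharmonicity for continuous functions that avoids mean values: at every point there is a local
  harmonic function below \<open>v\<close> that touches it there. Both alternatives in the definition of a tract
  function have this property, and it passes to sums and to compositions with holomorphic maps, while a
  maximum principle holds. Harmonic functions appear as real parts of holomorphic functions.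
\<close>
definition harmonically_supported :: "(complex \<Rightarrow> real) \<Rightarrow> complex set \<Rightarrow> bool" where
  "harmonically_supported v S \<longleftrightarrow>
     (\<forall>z\<in>S. \<exists>e>0. \<exists>g. g holomorphic_on ball z e \<and>
        (\<forall>w\<in>ball z e. Re (g w) \<le> v w) \<and> Re (g z) = v z)"

lemma harmonically_supportedE:
  assumes "harmonically_supported v S" "z \<in> S"
  obtains e g where "e > 0" "g holomorphic_on ball z e"
    "\<And>w. w \<in> ball z e \<Longrightarrow> Re (g w) \<le> v w" "Re (g z) = v z"
  using assms unfolding harmonically_supported_def by blast

lemma harmonically_supported_subset:
  "harmonically_supported v S \<Longrightarrow> T \<subseteq> S \<Longrightarrow> harmonically_supported v T"
  unfolding harmonically_supported_def by blast

lemma harmonically_supported_add: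
  assumes "harmonically_supported u S" "harmonically_supported v S"
  shows "harmonically_supported (\<lambda>z. u z + v z) S"
  unfolding harmonically_supported_def
proof
  fix z assume z: "z \<in> S"
  obtain e g where g: "e > 0" "g holomorphic_on ball z e"
    "\<And>w. w \<in> ball z e \<Longrightarrow> Re (g w) \<le> u w" "Re (g z) = u z"
    using harmonically_supportedE[OF assms(1) z] by metis
  obtain d h where h: "d > 0" "h holomorphic_on ball z d"
    "\<And>w. w \<in> ball z d \<Longrightarrow> Re (h w) \<le> v w" "Re (h z) = v z"
    using harmonically_supportedE[OF assms(2) z] by metis
  have "(\<lambda>w. g w + h w) holomorphic_on ball z (min e d)"
    using g(2) h(2) by (intro holomorphic_on_add) (auto intro: holomorphic_on_subset)
  moreover have "Re (g w + h w) \<le> u w + v w" if "w \<in> ball z (min e d)" for w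
    using g(3)[of w] h(3)[of w] that by auto
  ultimately show "\<exists>e>0. \<exists>g. g holomorphic_on ball z e \<and>
        (\<forall>w\<in>ball z e. Re (g w) \<le> u w + v w) \<and> Re (g z) = u z + v z"
    using g(1,4) h(1,4) by (intro exI[of _ "min e d"] conjI exI[of _ "\<lambda>w. g w + h w"]) auto
qed

lemma harmonically_supported_Re:
  assumes "open S" "g holomorphic_on S"
  shows "harmonically_supported (\<lambda>z. Re (g z)) S"
  unfolding harmonically_supported_def
proof
  fix z assume "z \<in> S"
  then obtain e where "e > 0" "ball z e \<subseteq> S"
    using assms(1) open_contains_ball by blast
  then show "\<exists>e>0. \<exists>h. h holomorphic_on ball z e \<and>
        (\<forall>w\<in>ball z e. Re (h w) \<le> Re (g w)) \<and> Re (h z) = Re (g z)"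
    using assms(2) by (intro exI[of _ e] conjI exI[of _ g]) (auto intro: holomorphic_on_subset)
qed

lemma harmonically_supported_const [simp]: "harmonically_supported (\<lambda>z. c) S"
  using harmonically_supported_Re[of UNIV "\<lambda>_. complex_of_real c"]
  by (auto intro: harmonically_supported_subset)

lemma harmonically_supported_cmult:
  assumes "harmonically_supported v S" "c \<ge> 0"
  shows "harmonically_supported (\<lambda>z. c * v z) S"
  unfolding harmonically_supported_def
proof
  fix z assume z: "z \<in> S"
  obtain e g where g: "e > 0" "g holomorphic_on ball z e"
    "\<And>w. w \<in> ball z e \<Longrightarrow> Re (g w) \<le> v w" "Re (g z) = v z"
    using harmonically_supportedE[OF assms(1) z] by metis
  show "\<exists>e>0. \<exists>g. g holomorphic_on ball z e \<and>
        (\<forall>w\<in>ball z e. Re (g w) \<le> c * v w) \<and> Re (g z) = c * v z"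
    using g assms(2)
    by (intro exI[of _ e] conjI exI[of _ "\<lambda>w. of_real c * g w"])
       (auto intro!: holomorphic_intros mult_left_mono)
qed

lemma harmonically_supported_sum:
  assumes "\<And>i. i \<in> I \<Longrightarrow> harmonically_supported (v i) S"
  shows "harmonically_supported (\<lambda>z. \<Sum>i\<in>I. v i z) S"
  using assms
  by (induction I rule: infinite_finite_induct) (auto intro: harmonically_supported_add)

lemma harmonically_supported_compose:
  assumes v: "harmonically_supported v S" and T: "open T" and f: "f holomorphic_on T" "f ` T \<subseteq> S"
  shows "harmonically_supported (\<lambda>z. v (f z)) T"
  unfolding harmonically_supported_def
proof
  fix z assume z: "z \<in> T"
  then have "f z \<in> S" using f by auto
  then obtain e g where g: "e > 0" "g holomorphic_on ball (f z) e"
    "\<And>w. w \<in> ball (f z) e \<Longrightarrow> Re (g w) \<le> v w" "Re (g (f z)) = v (f z)"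
    using harmonically_supportedE[OF v] by metis
  have "continuous_on T f" using f holomorphic_on_imp_continuous_on by blast
  then have "open (T \<inter> f -` ball (f z) e)"
    using T by (simp add: continuous_open_preimage)
  moreover have "z \<in> T \<inter> f -` ball (f z) e" using z g by auto
  ultimately obtain d where d: "d > 0" "ball z d \<subseteq> T \<inter> f -` ball (f z) e"
    using open_contains_ball by blast
  have "(g \<circ> f) holomorphic_on ball z d"
    using d(2) f(1) g(2)
    by (intro holomorphic_on_compose_gen[of f _ g "ball (f z) e"])
       (auto intro: holomorphic_on_subset)
  then show "\<exists>e>0. \<exists>h. h holomorphic_on ball z e \<and>
        (\<forall>w\<in>ball z e. Re (h w) \<le> v (f w)) \<and> Re (h z) = v (f z)"
    using d g by (intro exI[of _ d] conjI exI[of _ "g \<circ> f"]) auto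
qed

lemma harmonically_supported_ln_norm:
  fixes c :: real
  assumes S: "open S" and F: "F holomorphic_on S" "\<And>z. z \<in> S \<Longrightarrow> F z \<noteq> 0"
  shows "harmonically_supported (\<lambda>z. c * ln (cmod (F z))) S"
  unfolding harmonically_supported_def
proof
  fix z assume "z \<in> S"
  then obtain e where e: "e > 0" "ball z e \<subseteq> S"
    using S open_contains_ball by blast
  then have "F holomorphic_on ball z e" using F holomorphic_on_subset by blast
  then obtain g where g: "g holomorphic_on ball z e" "\<And>w. w \<in> ball z e \<Longrightarrow> F w = exp (g w)"
    using contractible_imp_holomorphic_log[of F "ball z e"] F(2) e(2)
    by (metis convex_ball convex_imp_contractible subsetD)
  have "Re (g w) = ln (cmod (F w))" if "w \<in> ball z e" for w
    using g(2)[OF that] by simp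
  then show "\<exists>e>0. \<exists>g. g holomorphic_on ball z e \<and>
     (\<forall>w\<in>ball z e. Re (g w) \<le> c * ln (cmod (F w))) \<and> Re (g z) = c * ln (cmod (F z))"
    using e g by (intro exI[of _ e] conjI exI[of _ "\<lambda>w. of_real c * g w"])
      (auto intro!: holomorphic_intros)
qed

text \<open>
  At a point where \<open>v\<close> attains its maximum over \<open>K\<close> the touching harmonic function attains its maximum, so
  it is constant, and \<open>v\<close> is squeezed between this constant and the maximum. Thus the set where the maximum is
  attained is open if it avoids \<open>K - G\<close>, and it is closed and bounded, which is impossible in the plane.
\<close>
theorem harmonically_supported_maximum_principle:
  assumes K: "compact K" and G: "open G" "G \<subseteq> K"
    and v: "continuous_on K v" "harmonically_supported v G"
    and bd: "\<And>z. z \<in> K - G \<Longrightarrow> v z \<le> m" and z: "z \<in> K"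
  shows "v z \<le> m"
proof (rule ccontr)
  assume neg: "\<not> v z \<le> m"
  obtain z0 where z0: "z0 \<in> K" "\<And>w. w \<in> K \<Longrightarrow> v w \<le> v z0"
    using continuous_attains_sup[OF K _ v(1)] z by blast
  have big: "v z0 > m" using z0(2)[OF z] neg by auto
  define M where "M = {w \<in> K. v w = v z0}"
  have MG: "M \<subseteq> G" using bd big unfolding M_def by force
  have "closed M"
    using continuous_closed_preimage_constant[OF v(1)] K compact_imp_closed
    unfolding M_def by blast
  moreover have "open M"
    unfolding open_contains_ball
  proof
    fix w assume w: "w \<in> M"
    then obtain e g where g: "e > 0" "g holomorphic_on ball w e"
      "\<And>x. x \<in> ball w e \<Longrightarrow> Re (g x) \<le> v x" "Re (g w) = v w"
      using harmonically_supportedE[OF v(2)] MG by (metis subsetD)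
    obtain d where d: "d > 0" "ball w d \<subseteq> G"
      using G MG w open_contains_ball by blast
    define S where "S = ball w (min e d)"
    have S: "S \<subseteq> ball w e" "S \<subseteq> G" "w \<in> S" "open S" "connected S"
      unfolding S_def using d g by auto
    have vw: "v w = v z0" using w by (simp add: M_def)
    have le: "Re (g x) \<le> v x" "v x \<le> v z0" if "x \<in> S" for x
      using g(3)[of x] z0(2)[of x] S G that by auto
    \<comment> \<open>The maximum modulus principle for \<open>exp g\<close> is the maximum principle for \<open>Re g\<close>.\<close>
    have "(\<lambda>x. exp (g x)) constant_on S"
    proof (rule maximum_modulus_principle[where U = S and \<xi> = w])
      show "(\<lambda>x. exp (g x)) holomorphic_on S"
        using g(2) S by (intro holomorphic_intros) (auto intro: holomorphic_on_subset)
      show "cmod (exp (g x)) \<le> cmod (exp (g w))" if "x \<in> S" for x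
        using le[OF that] g(4) vw by simp
    qed (use S in auto)
    then obtain c where c: "\<And>x. x \<in> S \<Longrightarrow> exp (g x) = c"
      unfolding constant_on_def by blast
    have "v x = v z0" if x: "x \<in> S" for x
    proof -
      have "exp (Re (g x)) = exp (Re (g w))"
        using c[OF x] c[OF S(3)] by (metis norm_exp_eq_Re)
      then show ?thesis using le[OF x] g(4) vw by simp
    qed
    then have "S \<subseteq> M" using S G unfolding M_def by blast
    then show "\<exists>e>0. ball w e \<subseteq> M"
      unfolding S_def using d g by (intro exI[of _ "min e d"]) auto
  qed
  ultimately have "M = {} \<or> M = UNIV" using clopen by blast
  moreover have "z0 \<in> M" using z0 by (simp add: M_def)
  moreover have "bounded M"
    by (rule bounded_subset[OF compact_imp_bounded[OF K]]) (simp add: M_def)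
  ultimately show False using not_bounded_UNIV[where 'a = complex] by auto
qed

text \<open>
  Subtract the multiple of \<open>ln |z|\<close> that makes the two boundary bounds equal.
\<close>
lemma harmonically_supported_three_circles:
  assumes s: "0 < s1" "s1 < s" "s < s2"
    and v: "continuous_on {z. s1 \<le> cmod z \<and> cmod z \<le> s2} v"
      "harmonically_supported v {z. s1 < cmod z \<and> cmod z < s2}"
    and b1: "\<And>z. cmod z = s1 \<Longrightarrow> v z \<le> b1" and b2: "\<And>z. cmod z = s2 \<Longrightarrow> v z \<le> b2"
    and z: "cmod z = s"
  shows "v z \<le> b1 + (b2 - b1) * ((ln s - ln s1) / (ln s2 - ln s1))"
proof -
  define c where "c = (b2 - b1) / (ln s2 - ln s1)"
  define K where "K = {z. s1 \<le> cmod z \<and> cmod z \<le> s2}"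
  define G where "G = {z. s1 < cmod z \<and> cmod z < s2}"
  define u where "u z = v z + (- c) * ln (cmod z)" for z
  have ls: "ln s2 - ln s1 > 0" using s by simp
  have "closed K" unfolding K_def
    by (intro closed_Collect_conj closed_Collect_le continuous_intros)
  moreover have "bounded K" unfolding K_def by (auto simp: bounded_iff)
  ultimately have "compact K" using compact_eq_bounded_closed by blast
  moreover have oG: "open G" unfolding G_def
    by (intro open_Collect_conj open_Collect_less continuous_intros)
  moreover have "G \<subseteq> K" by (auto simp: G_def K_def)
  moreover have "continuous_on K u" unfolding u_def
    using v(1) s(1) unfolding K_def by (intro continuous_intros) auto
  moreover have "harmonically_supported u G"
    unfolding u_def
    by (intro harmonically_supported_add harmonically_supported_ln_norm)
       (use v(2) oG s(1) in \<open>auto simp: G_def\<close>)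
  moreover have "u w \<le> b1 - c * ln s1" if "w \<in> K - G" for w
  proof -
    from that consider "cmod w = s1" | "cmod w = s2" unfolding K_def G_def by force
    then show ?thesis
    proof cases
      case 1 then show ?thesis using b1[of w] by (simp add: u_def)
    next
      case 2
      have "c * (ln s2 - ln s1) = b2 - b1" using ls by (simp add: c_def)
      then show ?thesis using 2 b2[of w] by (simp add: u_def algebra_simps)
    qed
  qed
  moreover have "z \<in> K" using z s by (simp add: K_def)
  ultimately have "u z \<le> b1 - c * ln s1"
    by (rule harmonically_supported_maximum_principle)
  then have "v z \<le> b1 + c * (ln s - ln s1)" using z by (simp add: u_def algebra_simps)
  then show ?thesis by (simp add: c_def)
qed

section \<open>Circle means\<close>

text \<open>
  The point of this form is that one \<open>N\<close> serves for all starting points \<open>\<theta>\<close>.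
\<close>
lemma periodic_Riemann_sum:
  fixes q :: "real \<Rightarrow> real"
  assumes q: "continuous_on UNIV q" and per: "\<And>x. q (x + 1) = q x" and eps: "\<epsilon> > 0"
  shows "\<exists>N0>0. \<forall>N\<ge>N0. \<forall>\<theta>\<in>{0..1}.
           \<bar>(\<Sum>k<N. q (\<theta> + real k / real N)) / real N - integral {0..1} q\<bar> \<le> \<epsilon>"
proof -
  have qc: "continuous_on A q" for A using q continuous_on_subset by blast
  have qi: "q integrable_on {x..y}" for x y
    using qc integrable_continuous_real by blast
  have "uniformly_continuous_on {0..2} q"
    using qc compact_uniformly_continuous by blast
  then obtain \<delta> where \<delta>: "\<delta> > 0"
    "\<And>x y. x \<in> {0..2} \<Longrightarrow> y \<in> {0..2} \<Longrightarrow> dist y x < \<delta> \<Longrightarrow> dist (q y) (q x) < \<epsilon>"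
    using eps unfolding uniformly_continuous_on_def by metis
  obtain N0 :: nat where N0: "N0 > 0" "1 / real N0 < \<delta>"
    using \<delta>(1) real_arch_inverse[of \<delta>] by (auto simp: inverse_eq_divide)
  have "\<bar>(\<Sum>k<N. q (\<theta> + real k / real N)) / real N - integral {0..1} q\<bar> \<le> \<epsilon>"
    if N: "N \<ge> N0" and \<theta>: "\<theta> \<in> {0..1}" for N \<theta>
  proof -
    have Npos: "N > 0" using N N0 by simp
    have N\<delta>: "1 / real N < \<delta>"
      using N N0 by (smt (verit) frac_le of_nat_0_less_iff of_nat_le_iff)
    define c where "c k = \<theta> + real k / real N" for k
    have cS: "c (Suc k) = c k + 1 / real N" for k by (simp add: c_def add_divide_distrib)
    have step: "\<bar>(\<Sum>j<k. q (c j) / real N) - integral {\<theta>..c k} q\<bar> \<le> \<epsilon> * (real k / real N)"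
      if "k \<le> N" for k
      using that
    proof (induction k)
      case 0 then show ?case by (simp add: c_def)
    next
      case (Suc k)
      have kN: "real (Suc k) \<le> real N" using Suc.prems by simp
      then have "real (Suc k) / real N \<le> 1" using Npos by simp
      then have "c (Suc k) \<le> 2" using \<theta> unfolding c_def atLeastAtMost_iff by linarith
      moreover have "0 \<le> c k" "\<theta> \<le> c k" "c k \<le> c (Suc k)"
        using \<theta> Npos cS[of k] by (auto simp: c_def)
      ultimately have c2: "c (Suc k) \<le> 2" "0 \<le> c k" "\<theta> \<le> c k" "c k \<le> c (Suc k)" by auto
      have split: "integral {\<theta>..c (Suc k)} q = integral {\<theta>..c k} q + integral {c k..c (Suc k)} q"
        using Henstock_Kurzweil_Integration.integral_combine[OF c2(3,4) qi] by simp
      have "norm (integral {c k..c (Suc k)} (\<lambda>x. q (c k) - q x))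
          \<le> integral {c k..c (Suc k)} (\<lambda>x. \<epsilon>)"
      proof (rule integral_norm_bound_integral)
        fix x assume x: "x \<in> {c k..c (Suc k)}"
        have "dist (q (c k)) (q x) < \<epsilon>"
          using x c2 cS[of k] N\<delta> by (intro \<delta>(2)) (auto simp: dist_real_def)
        then show "norm (q (c k) - q x) \<le> \<epsilon>" by (simp add: dist_real_def)
      qed (auto intro!: integrable_diff qi)
      also have "\<dots> = \<epsilon> / real N" using cS[of k] c2 by simp
      also have "integral {c k..c (Suc k)} (\<lambda>x. q (c k) - q x)
          = q (c k) / real N - integral {c k..c (Suc k)} q"
        using cS[of k] c2 by (subst integral_diff) (auto intro!: qi)
      finally have "\<bar>q (c k) / real N - integral {c k..c (Suc k)} q\<bar> \<le> \<epsilon> / real N" by simp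
      moreover have "\<bar>(\<Sum>j<k. q (c j) / real N) - integral {\<theta>..c k} q\<bar> \<le> \<epsilon> * (real k / real N)"
        using Suc by simp
      ultimately show ?case unfolding split
        by (simp add: add_divide_distrib algebra_simps)
    qed
    have "integral {\<theta>..\<theta> + 1} q = integral {\<theta>..1} q + integral {1..\<theta> + 1} q"
      using Henstock_Kurzweil_Integration.integral_combine[of \<theta> 1 "\<theta> + 1" q] \<theta> qi by simp
    also have "integral {1..\<theta> + 1} q = integral {0..\<theta>} q"
      using integral_shift[of 0 1 \<theta> q] qc per by (simp add: o_def)
    also have "integral {\<theta>..1} q + \<dots> = integral {0..1} q"
      using Henstock_Kurzweil_Integration.integral_combine[of 0 \<theta> 1 q] \<theta> qi by simp
    finally have "integral {\<theta>..c N} q = integral {0..1} q"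
      using Npos by (simp add: c_def)
    then show ?thesis
      using step[of N] Npos by (simp add: c_def sum_divide_distrib)
  qed
  then show ?thesis using N0 by blast
qed

definition circle_mean :: "(complex \<Rightarrow> real) \<Rightarrow> real \<Rightarrow> real" where
  "circle_mean v s = integral {0..1} (\<lambda>x. v (circlepath 0 s x))"

text \<open>
  Means over finitely many rotations are finite sums of compositions, so they inherit harmonic support, and
  they converge to the mean over the circle. Facts on circle means are obtained from them in the limit.
\<close>
definition rotation_mean :: "nat \<Rightarrow> (complex \<Rightarrow> real) \<Rightarrow> complex \<Rightarrow> real" where
  "rotation_mean N v z = (\<Sum>k<N. v (z * cis (2 * pi * (real k / real N)))) / real N"

lemma circlepath_0_cis: "circlepath 0 s x = of_real s * cis (2 * pi * x)"
  by (simp add: circlepath cis_conv_exp mult_ac)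

lemma norm_circlepath_0 [simp]: "s \<ge> 0 \<Longrightarrow> cmod (circlepath 0 s x) = s"
  by (simp add: circlepath_0_cis norm_mult)

lemma continuous_on_circlepath_compose:
  assumes "continuous_on (sphere 0 s) v" "s \<ge> 0"
  shows "continuous_on A (\<lambda>x. v (circlepath 0 s x))"
  by (rule continuous_on_compose2[OF assms(1)])
     (use assms(2) in \<open>auto simp: circlepath_0_cis norm_mult intro!: continuous_intros\<close>)

lemma rotation_mean_tendsto_circle_mean:
  assumes v: "continuous_on (sphere 0 s) v" and s: "s \<ge> 0" and eps: "\<epsilon> > 0"
  shows "\<forall>\<^sub>F N in sequentially. \<forall>z\<in>sphere 0 s. \<bar>rotation_mean N v z - circle_mean v s\<bar> \<le> \<epsilon>"
proof -
  define q where "q x = v (circlepath 0 s x)" for x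
  have "continuous_on UNIV q"
    using continuous_on_circlepath_compose[OF v s] by (simp add: q_def)
  moreover have "q (x + 1) = q x" for x
    by (simp add: q_def circlepath_0_cis distrib_left flip: cis_mult)
  ultimately obtain N0 where N0: "N0 > 0" "\<And>N \<theta>. N \<ge> N0 \<Longrightarrow> \<theta> \<in> {0..1} \<Longrightarrow>
           \<bar>(\<Sum>k<N. q (\<theta> + real k / real N)) / real N - integral {0..1} q\<bar> \<le> \<epsilon>"
    using periodic_Riemann_sum[OF _ _ eps, of q] by metis
  have "\<bar>rotation_mean N v z - circle_mean v s\<bar> \<le> \<epsilon>" if N: "N \<ge> N0" and z: "z \<in> sphere 0 s" for N z
  proof -
    have "z \<in> sphere 0 s" "path_image (circlepath 0 s) = sphere 0 s" using z s by auto
    then obtain \<theta> where \<theta>: "\<theta> \<in> {0..1}" "z = circlepath 0 s \<theta>"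
      unfolding path_image_def by blast
    have "q (\<theta> + real k / real N) = v (z * cis (2 * pi * (real k / real N)))" for k
      by (simp add: q_def \<theta>(2) circlepath_0_cis distrib_left flip: cis_mult)
         (simp add: mult_ac)
    then show ?thesis
      using N0(2)[OF N \<theta>(1)] by (simp add: rotation_mean_def circle_mean_def q_def[abs_def])
  qed
  then show ?thesis unfolding eventually_sequentially by blast
qed

lemma rotation_mean_continuous_supported:
  assumes v: "continuous_on (ball 0 T) v" "harmonically_supported v (ball 0 T)"
  shows "continuous_on (ball 0 T) (rotation_mean N v)"
    and "harmonically_supported (rotation_mean N v) (ball 0 T)"
proof -
  have sub: "(\<lambda>z. z * cis a) ` ball 0 T \<subseteq> ball 0 T" for a
    by (auto simp: norm_mult)
  have "continuous_on (ball 0 T) (\<lambda>z. v (z * cis a))" for a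
    by (rule continuous_on_compose2[OF v(1)]) (use sub in \<open>auto intro!: continuous_intros\<close>)
  then show "continuous_on (ball 0 T) (rotation_mean N v)"
    unfolding rotation_mean_def divide_inverse
    by (intro continuous_intros)
  have "harmonically_supported (\<lambda>z. v (z * cis a)) (ball 0 T)" for a
    by (rule harmonically_supported_compose[OF v(2)]) (use sub in \<open>auto intro!: holomorphic_intros\<close>)
  then have "harmonically_supported (\<lambda>z. inverse (real N) * (\<Sum>k<N. v (z * cis (2 * pi * (real k / real N)))))
      (ball 0 T)"
    by (intro harmonically_supported_cmult harmonically_supported_sum) auto
  then show "harmonically_supported (rotation_mean N v) (ball 0 T)"
    unfolding rotation_mean_def divide_inverse by (simp add: mult.commute)
qed

text \<open>
  The three circles theorem for the rotation means, which are almost constant on each of the three circles.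
\<close>
theorem circle_mean_three_circles:
  assumes v: "continuous_on (ball 0 T) v" "harmonically_supported v (ball 0 T)"
    and s: "0 < s1" "s1 < s" "s < s2" "s2 < T"
  shows "circle_mean v s \<le> circle_mean v s1 +
    (circle_mean v s2 - circle_mean v s1) * ((ln s - ln s1) / (ln s2 - ln s1))"
proof (rule field_le_epsilon)
  fix e :: real assume e: "e > 0"
  have cont: "continuous_on (sphere 0 t) v" if "t < T" for t
    using that by (intro continuous_on_subset[OF v(1)]) auto
  have ev: "\<forall>\<^sub>F N in sequentially. \<forall>z\<in>sphere 0 t. \<bar>rotation_mean N v z - circle_mean v t\<bar> \<le> e/2"
    if "0 < t" "t < T" for t
    using rotation_mean_tendsto_circle_mean[OF cont, of t "e/2"] that e by simp
  have "\<forall>\<^sub>F N in sequentially. \<forall>z\<in>sphere 0 s1. \<bar>rotation_mean N v z - circle_mean v s1\<bar> \<le> e/2"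
    "\<forall>\<^sub>F N in sequentially. \<forall>z\<in>sphere 0 s. \<bar>rotation_mean N v z - circle_mean v s\<bar> \<le> e/2"
    "\<forall>\<^sub>F N in sequentially. \<forall>z\<in>sphere 0 s2. \<bar>rotation_mean N v z - circle_mean v s2\<bar> \<le> e/2"
    using s by (intro ev; linarith)+
  then have "\<forall>\<^sub>F N in sequentially.
      (\<forall>z\<in>sphere 0 s1. \<bar>rotation_mean N v z - circle_mean v s1\<bar> \<le> e/2) \<and>
      (\<forall>z\<in>sphere 0 s. \<bar>rotation_mean N v z - circle_mean v s\<bar> \<le> e/2) \<and>
      (\<forall>z\<in>sphere 0 s2. \<bar>rotation_mean N v z - circle_mean v s2\<bar> \<le> e/2)"
    by (simp add: eventually_conj_iff)
  then obtain N where
    N: "\<And>z. z\<in>sphere 0 s1 \<Longrightarrow> \<bar>rotation_mean N v z - circle_mean v s1\<bar> \<le> e/2"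
      "\<And>z. z\<in>sphere 0 s \<Longrightarrow> \<bar>rotation_mean N v z - circle_mean v s\<bar> \<le> e/2"
      "\<And>z. z\<in>sphere 0 s2 \<Longrightarrow> \<bar>rotation_mean N v z - circle_mean v s2\<bar> \<le> e/2"
    unfolding eventually_sequentially by blast
  have "rotation_mean N v (of_real s) \<le> (circle_mean v s1 + e/2) +
      ((circle_mean v s2 + e/2) - (circle_mean v s1 + e/2)) * ((ln s - ln s1) / (ln s2 - ln s1))"
  proof (rule harmonically_supported_three_circles[OF s(1-3)])
    show "continuous_on {z. s1 \<le> cmod z \<and> cmod z \<le> s2} (rotation_mean N v)"
      using s by (intro continuous_on_subset[OF rotation_mean_continuous_supported(1)[OF v]]) auto
    show "harmonically_supported (rotation_mean N v) {z. s1 < cmod z \<and> cmod z < s2}"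
      using s by (intro harmonically_supported_subset[OF rotation_mean_continuous_supported(2)[OF v]]) auto
    show "rotation_mean N v z \<le> circle_mean v s1 + e/2" if "cmod z = s1" for z
      using N(1)[of z] that unfolding mem_sphere_0 by linarith
    show "rotation_mean N v z \<le> circle_mean v s2 + e/2" if "cmod z = s2" for z
      using N(3)[of z] that unfolding mem_sphere_0 by linarith
  qed (use s in auto)
  moreover have "\<bar>rotation_mean N v (of_real s) - circle_mean v s\<bar> \<le> e/2"
    using N(2)[of "of_real s"] s by (metis abs_of_pos less_trans mem_sphere_0 norm_of_real)
  ultimately show "circle_mean v s \<le> circle_mean v s1 +
    (circle_mean v s2 - circle_mean v s1) * ((ln s - ln s1) / (ln s2 - ln s1)) + e"
    unfolding add_diff_cancel_right by linarith
qed

lemma circle_mean_ge_center: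
  assumes v: "continuous_on (ball 0 T) v" "harmonically_supported v (ball 0 T)"
    and s: "0 < s" "s < T"
  shows "v 0 \<le> circle_mean v s"
proof (rule field_le_epsilon)
  fix e :: real assume e: "e > 0"
  have "continuous_on (sphere 0 s) v"
    using s by (intro continuous_on_subset[OF v(1)]) auto
  then have "\<forall>\<^sub>F N in sequentially. \<forall>z\<in>sphere 0 s. \<bar>rotation_mean N v z - circle_mean v s\<bar> \<le> e"
    using rotation_mean_tendsto_circle_mean e s by simp
  then obtain N where N: "N > 0"
    "\<And>z. z \<in> sphere 0 s \<Longrightarrow> \<bar>rotation_mean N v z - circle_mean v s\<bar> \<le> e"
    unfolding eventually_sequentially by (metis le_add1 le_add2 less_add_one less_le_trans)
  have "rotation_mean N v 0 \<le> circle_mean v s + e"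
  proof (rule harmonically_supported_maximum_principle[where K = "cball 0 s" and G = "ball 0 s"])
    show "continuous_on (cball 0 s) (rotation_mean N v)"
      using s by (intro continuous_on_subset[OF rotation_mean_continuous_supported(1)[OF v]]) auto
    show "harmonically_supported (rotation_mean N v) (ball 0 s)"
      using s by (intro harmonically_supported_subset[OF rotation_mean_continuous_supported(2)[OF v]]) auto
    show "rotation_mean N v z \<le> circle_mean v s + e" if "z \<in> cball 0 s - ball 0 s" for z
      using N(2)[of z] that by auto
  qed (use s in auto)
  moreover have "rotation_mean N v 0 = v 0" using N(1) by (simp add: rotation_mean_def)
  ultimately show "v 0 \<le> circle_mean v s + e" by simp
qed

text \<open>
  Both circle means and circle maxima are convex functions of the logarithm of the radius for this reason.
\<close>
lemma convex_on_of_three_circles: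
  fixes m :: "real \<Rightarrow> real"
  assumes T: "T > 0" and m: "\<And>s1 s s2. 0 < s1 \<Longrightarrow> s1 < s \<Longrightarrow> s < s2 \<Longrightarrow> s2 < T \<Longrightarrow>
    m s \<le> m s1 + (m s2 - m s1) * ((ln s - ln s1) / (ln s2 - ln s1))"
  shows "convex_on {..<ln T} (\<lambda>t. m (exp t))"
proof (rule convex_on_linorderI)
  fix t x y :: real
  assume t: "t > 0" "t < 1" and xy: "x \<in> {..<ln T}" "y \<in> {..<ln T}" "x < y"
  define w where "w = (1 - t) *\<^sub>R x + t *\<^sub>R y"
  have w: "w - x = t * (y - x)" "y - w = (1 - t) * (y - x)"
    by (auto simp: w_def algebra_simps)
  then have "x < w" "w < y" using t xy by (auto simp: zero_less_mult_iff dest!: sym[of "w - x"])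
     (smt (verit) mult_pos_pos)+
  moreover have "exp y < T" using xy T by (metis exp_less_cancel_iff exp_ln lessThan_iff)
  ultimately have "m (exp w) \<le> m (exp x) + (m (exp y) - m (exp x)) * ((w - x) / (y - x))"
    using m[of "exp x" "exp w" "exp y"] by simp
  also have "(w - x) / (y - x) = t" using w xy by simp
  finally show "m (exp ((1 - t) *\<^sub>R x + t *\<^sub>R y)) \<le> (1 - t) * m (exp x) + t * m (exp y)"
    by (simp add: w_def algebra_simps)
qed simp

section \<open>The slope of circle means and winding numbers\<close>

text \<open>
  Locally \<open>ln |F|\<close> is the real part of a logarithm \<open>g\<close> of \<open>F\<close>, and \<open>g' = F' / F\<close>.
\<close>
lemma ln_norm_has_real_derivative:
  assumes A: "open A" and F: "F holomorphic_on A" "\<And>z. z \<in> A \<Longrightarrow> F z \<noteq> 0"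
    and s: "of_real s * e \<in> A"
  shows "((\<lambda>s. ln (cmod (F (of_real s * e)))) has_real_derivative
           Re (deriv F (of_real s * e) / F (of_real s * e) * e)) (at s)"
proof -
  define z where "z = of_real s * e"
  obtain d where d: "d > 0" "ball z d \<subseteq> A"
    using A s open_contains_ball unfolding z_def by blast
  then have "F holomorphic_on ball z d" using F holomorphic_on_subset by blast
  then obtain g where g: "g holomorphic_on ball z d" "\<And>w. w \<in> ball z d \<Longrightarrow> F w = exp (g w)"
    using contractible_imp_holomorphic_log[of F "ball z d"] F(2) d(2)
    by (metis convex_ball convex_imp_contractible subsetD)
  have dg: "(g has_field_derivative deriv g z) (at z)"
    using g(1) d(1) by (intro holomorphic_derivI[of g "ball z d"]) auto
  have "((\<lambda>w. exp (g w)) has_field_derivative exp (g z) * deriv g z) (at z)"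
    using dg by (auto intro!: derivative_eq_intros)
  then have "(F has_field_derivative F z * deriv g z) (at z)"
    using d(1) g(2) by (subst DERIV_cong_ev[OF refl _ refl])
      (auto intro!: eventually_at_ball' simp: eventually_nhds_metric dist_commute)
  then have dF: "deriv g z = deriv F z / F z"
    using DERIV_imp_deriv F(2) s z_def by fastforce
  have "((\<lambda>s. of_real s * e) has_vector_derivative e) (at s)"
    by (auto intro!: derivative_eq_intros)
  then have "((g \<circ> (\<lambda>s. of_real s * e)) has_vector_derivative e * deriv g z) (at s)"
    using dg unfolding z_def by (rule field_vector_diff_chain_at)
  then have "((\<lambda>s. Re (g (of_real s * e))) has_real_derivative Re (e * deriv g z)) (at s)"
    unfolding has_real_derivative_iff_has_vector_derivative
    using bounded_linear.has_vector_derivative[OF bounded_linear_Re] by (fastforce simp: o_def)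
  moreover have "\<forall>\<^sub>F t in nhds s. ln (cmod (F (of_real t * e))) = Re (g (of_real t * e))"
  proof -
    have "open ((\<lambda>t. of_real t * e) -` ball z d)"
      by (intro open_vimage continuous_intros) auto
    then have "\<forall>\<^sub>F t in nhds s. t \<in> (\<lambda>t. of_real t * e) -` ball z d"
      using d(1) by (intro eventually_nhds_in_open) (auto simp: z_def)
    then show ?thesis by eventually_elim (auto simp: g(2))
  qed
  ultimately have "((\<lambda>s. ln (cmod (F (of_real s * e)))) has_real_derivative Re (e * deriv g z)) (at s)"
    by (rule DERIV_cong_ev[OF refl _ refl, THEN iffD2, rotated])
  then show ?thesis unfolding z_def[symmetric] dF by (simp only: mult.commute)
qed

text \<open>
  Differentiation under the integral sign turns the mean of \<open>ln |F|\<close> into the real part of the mean of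
  \<open>z F'(z) / F(z)\<close>, which is the integral that defines the winding number of the image of the circle. In
  terms of potential theory, the mass that \<open>ln |F|\<close> carries inside the circle is an integer.
\<close>
lemma circle_mean_ln_norm_has_real_derivative:
  fixes \<kappa> :: real
  defines "A \<equiv> {z. 1 - \<kappa> < cmod z \<and> cmod z < 1 + \<kappa>}"
  assumes \<kappa>: "0 < \<kappa>" "\<kappa> \<le> 1" and F: "F holomorphic_on A" "\<And>z. z \<in> A \<Longrightarrow> F z \<noteq> 0"
  shows "(circle_mean (\<lambda>z. ln (cmod (F z))) has_real_derivative
           Re (winding_number (F \<circ> circlepath 0 1) 0)) (at 1)"
proof -
  define e where "e x = cis (2 * pi * x)" for x :: real
  define D where "D s x = Re (deriv F (of_real s * e x) / F (of_real s * e x) * e x)" for s x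
  define I where "I = {1 - \<kappa> <..< 1 + \<kappa>}"
  have A: "open A" unfolding A_def
    by (intro open_Collect_conj open_Collect_less continuous_intros)
  have inA: "of_real s * e x \<in> A" if "s \<in> I" for s x
    using that \<kappa> by (auto simp: I_def A_def e_def norm_mult)
  have contF: "continuous_on A F" "continuous_on A (deriv F)"
    using F(1) A by (auto intro!: holomorphic_on_imp_continuous_on holomorphic_deriv)
  have "((\<lambda>s. integral (cbox 0 1) (\<lambda>x. ln (cmod (F (of_real s * e x))))) has_field_derivative
      integral (cbox 0 1) (D 1)) (at 1 within I)"
  proof (rule leibniz_rule_field_derivative)
    fix s x :: real assume s: "s \<in> I"
    show "((\<lambda>s. ln (cmod (F (of_real s * e x)))) has_real_derivative D s x) (at s within I)"
      unfolding D_def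
      by (rule has_field_derivative_at_within, rule ln_norm_has_real_derivative[OF A F inA[OF s]])
  next
    fix s :: real assume s: "s \<in> I"
    have "continuous_on {0..1} (\<lambda>x. F (of_real s * e x))"
      by (rule continuous_on_compose2[OF contF(1)])
         (use inA[OF s] in \<open>auto simp: e_def intro!: continuous_intros\<close>)
    then show "(\<lambda>x. ln (cmod (F (of_real s * e x)))) integrable_on cbox 0 1"
      using F(2) inA[OF s] by (auto intro!: integrable_continuous_real continuous_intros)
  next
    have "continuous_on (I \<times> cbox 0 1) (\<lambda>p. F (of_real (fst p) * e (snd p)))"
      by (rule continuous_on_compose2[OF contF(1)])
         (use inA in \<open>auto simp: e_def intro!: continuous_intros\<close>)
    moreover have "continuous_on (I \<times> cbox 0 1) (\<lambda>p. deriv F (of_real (fst p) * e (snd p)))"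
      by (rule continuous_on_compose2[OF contF(2)])
         (use inA in \<open>auto simp: e_def intro!: continuous_intros\<close>)
    ultimately have "continuous_on (I \<times> cbox 0 1) (\<lambda>p. Re (deriv F (of_real (fst p) * e (snd p)) /
        F (of_real (fst p) * e (snd p)) * e (snd p)))"
      using F(2) inA by (intro continuous_intros) (auto simp: e_def intro!: continuous_intros)
    then show "continuous_on (I \<times> cbox 0 1) (\<lambda>(s, x). D s x)"
      by (simp add: D_def case_prod_unfold)
  qed (use \<kappa> in \<open>auto simp: I_def\<close>)
  then have deriv: "(circle_mean (\<lambda>z. ln (cmod (F z))) has_real_derivative integral {0..1} (D 1)) (at 1)"
    using at_within_open[of 1 I] \<kappa>
    by (simp add: circle_mean_def[abs_def] circlepath_0_cis e_def I_def)
  have pA: "path_image (circlepath 0 1) \<subseteq> A" using \<kappa> by (auto simp: A_def)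
  have "winding_number (F \<circ> circlepath 0 1) 0
      = 1/(2*pi*\<i>) * contour_integral (F \<circ> circlepath 0 1) (\<lambda>w. 1/(w - 0))"
    using pA F by (intro winding_number_valid_path valid_path_compose_holomorphic[OF _ F(1) A])
      (auto simp: path_image_compose)
  also have "contour_integral (F \<circ> circlepath 0 1) (\<lambda>w. 1/(w - 0)) =
      contour_integral (circlepath 0 1) (\<lambda>w. deriv F w * (1 / (F w - 0)))"
    using A F pA by (intro contour_integral_comp_analyticW[where s = A]) (auto simp: analytic_on_open)
  also have "\<dots> = integral {0..1} (\<lambda>x. (2*pi*\<i>) * (deriv F (e x) / F (e x) * e x))"
    unfolding contour_integral_integral
    by (intro integral_cong)
       (auto simp: vector_derivative_circlepath circlepath_0_cis e_def cis_conv_exp mult_ac)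
  also have "\<dots> = (2*pi*\<i>) * integral {0..1} (\<lambda>x. deriv F (e x) / F (e x) * e x)"
    by (rule integral_mult_right)
  finally have w: "winding_number (F \<circ> circlepath 0 1) 0 = integral {0..1} (\<lambda>x. deriv F (e x) / F (e x) * e x)"
    by (simp add: o_def)
  have e1: "e x \<in> A" for x using inA[of 1 x] \<kappa> by (simp add: I_def)
  have "continuous_on {0..1} (\<lambda>x. F (e x))" "continuous_on {0..1} (\<lambda>x. deriv F (e x))"
    by (rule continuous_on_compose2[OF contF(1)] continuous_on_compose2[OF contF(2)];
        use e1 in \<open>auto simp: e_def intro!: continuous_intros\<close>)+
  then have "(\<lambda>x. deriv F (e x) / F (e x) * e x) integrable_on {0..1}"
    using e1 F(2) by (intro integrable_continuous_real continuous_intros) (auto simp: e_def intro!: continuous_intros)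
  then have "integral {0..1} (D 1) = Re (winding_number (F \<circ> circlepath 0 1) 0)"
    unfolding w D_def using has_integral_Re[OF integrable_integral] by (fastforce intro: integral_unique)
  then show ?thesis using deriv by simp
qed

text \<open>
  A convex function lies above its tangent, here at radius 1 in the variable \<open>ln s\<close>. Only the values of \<open>v\<close>
  near the unit circle have to come from a holomorphic function.
\<close>
lemma circle_mean_ge_tangent:
  assumes v: "continuous_on (ball 0 T) v" "harmonically_supported v (ball 0 T)" and T: "T > 1"
    and \<kappa>: "0 < \<kappa>" "\<kappa> \<le> 1" 
    and F: "F holomorphic_on {z. 1 - \<kappa> < cmod z \<and> cmod z < 1 + \<kappa>}"
      "\<And>z. 1 - \<kappa> < cmod z \<Longrightarrow> cmod z < 1 + \<kappa> \<Longrightarrow> F z \<noteq> 0 \<and> v z = ln (cmod (F z))"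
    and s: "0 < s" "s < T"
  shows "circle_mean v s \<ge> circle_mean v 1 + Re (winding_number (F \<circ> circlepath 0 1) 0) * ln s"
proof -
  define n where "n = Re (winding_number (F \<circ> circlepath 0 1) 0)"
  have "(circle_mean (\<lambda>z. ln (cmod (F z))) has_real_derivative n) (at 1)"
    unfolding n_def using \<kappa> F by (intro circle_mean_ln_norm_has_real_derivative) auto
  moreover have "\<forall>\<^sub>F t in nhds 1. circle_mean v t = circle_mean (\<lambda>z. ln (cmod (F z))) t"
  proof -
    have "\<forall>\<^sub>F t in nhds 1. t \<in> {1 - \<kappa><..<1 + \<kappa>}"
      using \<kappa> by (intro eventually_nhds_in_open) auto
    then show ?thesis
    proof eventually_elim
      case (elim t)
      then show ?case using \<kappa> F(2) by (auto simp: circle_mean_def intro!: integral_cong)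
    qed
  qed
  ultimately have d: "(circle_mean v has_real_derivative n) (at 1)"
    by (subst DERIV_cong_ev[OF refl _ refl]) auto
  have "((\<lambda>t. circle_mean v (exp t)) has_real_derivative n * exp 0) (at 0)"
    by (rule DERIV_chain2[where g = exp]) (use d in \<open>auto intro!: derivative_eq_intros\<close>)
  then have d0: "((\<lambda>t. circle_mean v (exp t)) has_real_derivative n) (at 0 within {..<ln T})"
    using has_field_derivative_at_within by fastforce
  have "convex_on {..<ln T} (\<lambda>t. circle_mean v (exp t))"
    using T by (intro convex_on_of_three_circles circle_mean_three_circles[OF v]) auto
  from convex_on_imp_above_tangent[OF this _ _ _ d0, of "ln s"]
  have "circle_mean v (exp (ln s)) - circle_mean v (exp 0) \<ge> n * (ln s - 0)"
    using T s by (auto simp: interior_open)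
  then show ?thesis using s by (simp add: n_def)
qed

section \<open>A circle on which the function is positive\<close>

lemma circle_mean_mono:
  assumes "continuous_on (sphere 0 s) u" "continuous_on (sphere 0 s) v" "s \<ge> 0"
    and "\<And>z. cmod z = s \<Longrightarrow> u z \<le> v z"
  shows "circle_mean u s \<le> circle_mean v s"
  unfolding circle_mean_def
  by (rule integral_le)
     (use assms in \<open>auto intro!: integrable_continuous_real continuous_on_circlepath_compose\<close>)

lemma circle_mean_const [simp]: "circle_mean (\<lambda>z. c) s = c"
  by (simp add: circle_mean_def)

lemma circle_mean_add_const:
  assumes "continuous_on (sphere 0 s) v" "s \<ge> 0"
  shows "circle_mean (\<lambda>z. v z + c) s = circle_mean v s + c"
  unfolding circle_mean_def
  by (subst integral_add)
     (use assms in \<open>auto intro!: integrable_continuous_real continuous_on_circlepath_compose\<close>)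

text \<open>
  Real parts of holomorphic functions and their negatives are both supported, so the mean value property follows
  from the inequality for the value at the centre.
\<close>
lemma circle_mean_Re:
  assumes g: "g holomorphic_on ball 0 T" and s: "0 < s" "s < T"
  shows "circle_mean (\<lambda>z. Re (g z)) s = Re (g 0)"
proof -
  have c: "continuous_on (ball 0 T) (\<lambda>z. Re (g z))" "continuous_on (ball 0 T) (\<lambda>z. Re (- g z))"
    using g by (auto intro!: continuous_intros holomorphic_on_imp_continuous_on)
  have "Re (g 0) \<le> circle_mean (\<lambda>z. Re (g z)) s"
    using circle_mean_ge_center[OF c(1) harmonically_supported_Re s] g by auto
  moreover have "Re (- g 0) \<le> circle_mean (\<lambda>z. Re (- g z)) s"
    using circle_mean_ge_center[OF c(2) harmonically_supported_Re s] g
    by (auto intro!: holomorphic_intros)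
  ultimately show ?thesis by (simp add: circle_mean_def)
qed

text \<open>
  The numerator and the denominator of the automorphism \<open>(z + a) / (1 + cnj a z)\<close> of the unit disc are
  compared by the identity for the difference of their squared moduli.
\<close>
lemma disc_automorphism_norm:
  assumes a: "cmod a < 1" and z: "cmod z \<le> 1"
  shows "cmod (z + a) \<le> cmod (1 + cnj a * z)" "1 + cnj a * z \<noteq> 0"
    "cmod z = 1 \<Longrightarrow> cmod (z + a) = cmod (1 + cnj a * z)"
proof -
  have eq: "(cmod (1 + cnj a * z))\<^sup>2 - (cmod (z + a))\<^sup>2 = (1 - (cmod a)\<^sup>2) * (1 - (cmod z)\<^sup>2)"
    unfolding cmod_power2 by (simp add: power2_eq_square algebra_simps)
  have "(1 - (cmod a)\<^sup>2) * (1 - (cmod z)\<^sup>2) \<ge> 0"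
    using a z by (intro mult_nonneg_nonneg) (auto simp: power_le_one)
  then have "(cmod (z + a))\<^sup>2 \<le> (cmod (1 + cnj a * z))\<^sup>2" using eq by linarith
  then show "cmod (z + a) \<le> cmod (1 + cnj a * z)"
    by (rule power2_le_imp_le) simp
  have "cmod (cnj a * z) < 1"
    using a z by (simp add: norm_mult) (metis mult_left_le norm_ge_zero order_le_less_trans)
  then show "1 + cnj a * z \<noteq> 0"
    by (metis add_eq_0_iff2 norm_minus_cancel norm_one less_irrefl)
  show "cmod (z + a) = cmod (1 + cnj a * z)" if "cmod z = 1"
  proof -
    have "(cmod (z + a))\<^sup>2 = (cmod (1 + cnj a * z))\<^sup>2" using eq that by simp
    then show ?thesis by (simp only: power2_eq_iff_nonneg norm_ge_zero)
  qed
qed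

lemma dist_sgn:
  fixes z :: complex
  assumes "z \<noteq> 0"
  shows "dist (sgn z) z = \<bar>1 - cmod z\<bar>"
proof -
  have "z = sgn z * of_real (cmod z)" using assms by (simp add: sgn_eq)
  then have "sgn z - z = sgn z * of_real (1 - cmod z)" by (simp add: algebra_simps)
  then show ?thesis using assms by (simp add: dist_norm norm_mult norm_sgn del: of_real_diff)
qed

lemma annulus_subset_open:
  assumes "open S" "sphere 0 1 \<subseteq> S"
  obtains \<kappa> :: real where "0 < \<kappa>" "\<kappa> \<le> 1" "{z :: complex. 1 - \<kappa> < cmod z \<and> cmod z < 1 + \<kappa>} \<subseteq> S"
proof -
  obtain \<epsilon> where \<epsilon>: "\<epsilon> > 0" "(\<Union>x\<in>sphere 0 1. ball x \<epsilon>) \<subseteq> S"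
    using compact_subset_open_imp_ball_epsilon_subset[OF compact_sphere assms] by metis
  have "z \<in> S" if z: "1 - min \<epsilon> 1 < cmod z" "cmod z < 1 + min \<epsilon> 1" for z
  proof -
    have nz: "cmod z > 0" using z by (auto simp: min_def split: if_splits)
    then have "z \<in> ball (sgn z) \<epsilon>" using z dist_sgn[of z] by auto
    moreover have "sgn z \<in> sphere 0 1" using nz by (simp add: norm_sgn)
    ultimately show ?thesis using \<epsilon>(2) by blast
  qed
  then show ?thesis using that[of "min \<epsilon> 1"] \<epsilon>(1) by auto
qed

text \<open>
  Let \<open>n\<close> be the winding number of \<open>F\<close> along the unit circle. The mean of \<open>V\<close> grows from the unit circle to the
  circle of radius \<open>e\<close> at least by \<open>n\<close> and at most by \<open>\<eta> < 1\<close>, so \<open>n \<le> 0\<close>. If \<open>V a = 0\<close>,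
  precompose with the disc automorphism that takes 0 to \<open>a\<close>. The winding number remains \<open>n\<close>, so the tangent
  inequality keeps the means over small circles above the mean over the unit circle, which is positive, while they
  tend to \<open>V a = 0\<close>.
\<close>
lemma positive_inside_isolating_circle:
  fixes V :: "complex \<Rightarrow> real"
  assumes V: "continuous_on (ball 0 4) V" "harmonically_supported V (ball 0 4)"
    "\<And>z. z \<in> ball 0 4 \<Longrightarrow> V z \<ge> 0"
    and \<kappa>: "0 < \<kappa>" "\<kappa> \<le> 1"
    and F: "F holomorphic_on {z. 1 - \<kappa> < cmod z \<and> cmod z < 1 + \<kappa>}"
      "\<And>z. 1 - \<kappa> < cmod z \<Longrightarrow> cmod z < 1 + \<kappa> \<Longrightarrow> F z \<noteq> 0 \<and> V z = ln (cmod (F z))"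
    and pos: "\<And>z. cmod z = 1 \<Longrightarrow> V z > 0"
    and G: "G holomorphic_on ball 0 4" "\<And>z. z \<in> ball 0 4 \<Longrightarrow> V z \<le> Re (G z) + \<eta>"
      "V 0 = Re (G 0)" and \<eta>: "\<eta> < 1"
    and a: "cmod a < 1"
  shows "V a > 0"
proof (rule ccontr)
  assume "\<not> V a > 0"
  then have Va: "V a = 0" using V(3)[of a] a by auto
  define A where "A = {z. 1 - \<kappa> < cmod z \<and> cmod z < 1 + \<kappa>}"
  have FA: "F holomorphic_on A" "\<And>z. z \<in> A \<Longrightarrow> F z \<noteq> 0" "\<And>z. z \<in> A \<Longrightarrow> V z = ln (cmod (F z))"
    using F unfolding A_def by auto
  define n where "n = Re (winding_number (F \<circ> circlepath 0 1) 0)"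
  have Vs: "continuous_on (sphere 0 s) V" if "s < 4" for s
    using that by (intro continuous_on_subset[OF V(1)]) auto
  have pA: "circlepath 0 1 x \<in> A" for x using \<kappa> by (simp add: A_def)
  have "winding_number (F \<circ> circlepath 0 1) 0 \<in> \<int>"
  proof (rule integer_winding_number)
    have "continuous_on (path_image (circlepath 0 1)) F"
      using FA(1) pA by (intro continuous_on_subset[OF holomorphic_on_imp_continuous_on])
        (auto simp: path_image_def)
    then show "path (F \<circ> circlepath 0 1)" by (intro path_continuous_image) auto
    show "0 \<notin> path_image (F \<circ> circlepath 0 1)"
      using FA(2) pA by (auto simp: path_image_def)
    show "pathfinish (F \<circ> circlepath 0 1) = pathstart (F \<circ> circlepath 0 1)"
      by (simp add: pathfinish_compose pathstart_compose)
  qed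
  then obtain k :: int where k: "n = of_int k" by (metis Ints_cases Re_complex_of_real n_def of_real_of_int_eq)
  have e1: "exp (1::real) < 4" using exp_le by linarith
  have "circle_mean V (exp 1) \<ge> circle_mean V 1 + n * ln (exp 1)"
    unfolding n_def by (rule circle_mean_ge_tangent[OF V(1,2) _ \<kappa> F]) (use e1 in auto)
  moreover have "circle_mean V 1 \<ge> V 0"
    using circle_mean_ge_center[OF V(1,2)] by simp
  moreover have "circle_mean V (exp 1) \<le> circle_mean (\<lambda>z. Re (G z) + \<eta>) (exp 1)"
    using e1 G by (intro circle_mean_mono Vs continuous_intros
        continuous_on_subset[OF holomorphic_on_imp_continuous_on[OF G(1)]]) auto
  moreover have "circle_mean (\<lambda>z. Re (G z) + \<eta>) (exp 1) = Re (G 0) + \<eta>"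
    using e1 G(1) circle_mean_Re[OF G(1), of "exp 1"]
    by (subst circle_mean_add_const)
       (auto intro!: continuous_intros continuous_on_subset[OF holomorphic_on_imp_continuous_on[OF G(1)]])
  ultimately have "n \<le> \<eta>" using G(3) by simp
  then have "real_of_int k < 1" using \<eta> k by linarith
  then have n0: "n \<le> 0" using k by simp
  define \<phi> where "\<phi> z = (z + a) / (1 + cnj a * z)" for z
  \<comment> \<open>The automorphism maps \<open>S\<close> into the disc of radius 4 and \<open>S2\<close> into the annulus where \<open>F\<close> is given.\<close>
  define S where "S = {z. cmod (z + a) < 4 * cmod (1 + cnj a * z)}"
  define S2 where "S2 = {z. (1 - \<kappa>) * cmod (1 + cnj a * z) < cmod (z + a)
    \<and> cmod (z + a) < (1 + \<kappa>) * cmod (1 + cnj a * z)} \<inter> {z. 1 + cnj a * z \<noteq> 0}"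
  have "open S" unfolding S_def by (intro open_Collect_less continuous_intros)
  moreover have "cball 0 1 \<subseteq> S"
  proof
    fix z :: complex assume "z \<in> cball 0 1"
    then have "cmod (z + a) \<le> cmod (1 + cnj a * z)" "cmod (1 + cnj a * z) > 0"
      using disc_automorphism_norm(1,2)[OF a, of z] by simp_all
    then show "z \<in> S" unfolding S_def mem_Collect_eq by linarith
  qed
  ultimately obtain \<epsilon> where \<epsilon>: "\<epsilon> > 0" "(\<Union>x\<in>cball 0 1. ball x \<epsilon>) \<subseteq> S"
    using compact_subset_open_imp_ball_epsilon_subset[OF compact_cball] by metis
  define T where "T = 1 + \<epsilon>"
  have TS: "z \<in> S" if "cmod z < T" for z
  proof (cases "cmod z \<le> 1")
    case True then show ?thesis using \<epsilon> by force
  next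
    case False
    then have "z \<noteq> 0" by auto
    then have "z \<in> ball (sgn z) \<epsilon>" using that False dist_sgn[of z] by (auto simp: T_def)
    moreover have "sgn z \<in> cball 0 1" by (simp add: norm_sgn)
    ultimately show ?thesis using \<epsilon>(2) by blast
  qed
  have nz: "1 + cnj a * z \<noteq> 0" if "z \<in> S" for z using that by (auto simp: S_def)
  have holS: "\<phi> holomorphic_on S" unfolding \<phi>_def using nz by (intro holomorphic_intros) auto
  have \<phi>4: "\<phi> z \<in> ball 0 4" if "z \<in> S" for z
    using nz[OF that] that by (simp add: S_def \<phi>_def norm_divide divide_simps)
  have sub: "ball 0 T \<subseteq> S" using TS by auto
  have "open S2" unfolding S2_def
    by (intro open_Int open_Collect_conj open_Collect_less open_Collect_neq continuous_intros)
  moreover have "sphere 0 1 \<subseteq> S2"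
    using disc_automorphism_norm[OF a] \<kappa> by (auto simp: S2_def)
  ultimately obtain \<mu> where \<mu>: "0 < \<mu>" "\<mu> \<le> 1" "{z. 1 - \<mu> < cmod z \<and> cmod z < 1 + \<mu>} \<subseteq> S2"
    by (rule annulus_subset_open)
  have \<phi>A: "\<phi> z \<in> A" if "z \<in> S2" for z
    using that by (simp add: S2_def A_def \<phi>_def norm_divide divide_simps)
  define W where "W z = V (\<phi> z)" for z
  have Wc: "continuous_on (ball 0 T) W" unfolding W_def
    by (rule continuous_on_compose2[OF V(1)])
       (use holS sub \<phi>4 in \<open>auto intro!: holomorphic_on_imp_continuous_on intro: holomorphic_on_subset\<close>)
  have Wh: "harmonically_supported W (ball 0 T)" unfolding W_def
    by (rule harmonically_supported_compose[OF V(2)])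
       (use holS sub \<phi>4 in \<open>auto intro: holomorphic_on_subset\<close>)
  have holS2: "\<phi> holomorphic_on S2" unfolding \<phi>_def by (intro holomorphic_intros) (auto simp: S2_def)
  have FS2: "(F \<circ> \<phi>) holomorphic_on S2"
    using holS2 FA(1) \<phi>A by (intro holomorphic_on_compose_gen[of _ _ _ A]) auto
  \<comment> \<open>Let the centre move from 0 to \<open>a\<close>: all automorphisms on the way preserve the unit circle.\<close>
  have "homotopic_loops (-{0}) (F \<circ> circlepath 0 1) ((F \<circ> \<phi>) \<circ> circlepath 0 1)"
    unfolding homotopic_loops
  proof (intro exI[of _ "\<lambda>p. F ((circlepath 0 1 (snd p) + of_real (fst p) * a) / (1 + cnj (of_real (fst p) * a) * circlepath 0 1 (snd p)))"] conjI ballI)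
    let ?h = "\<lambda>p. (circlepath 0 1 (snd p) + of_real (fst p) * a) / (1 + cnj (of_real (fst p) * a) * circlepath 0 1 (snd p))"
    have ta: "cmod (of_real t * a) < 1" if "t \<in> {0..1}" for t
      using a that by (simp add: norm_mult) (metis mult_left_le_one_le norm_ge_zero order_le_less_trans)
    have nzt: "1 + cnj (of_real t * a) * circlepath 0 1 x \<noteq> 0" if "t \<in> {0..1}" for t x
      using disc_automorphism_norm(2)[OF ta[OF that], of "circlepath 0 1 x"] by simp
    have hA: "?h p \<in> A" if "p \<in> {0..1} \<times> {0..1}" for p
    proof -
      have "fst p \<in> {0..1}" using that by auto
      then have "cmod (?h p) = 1"
        using disc_automorphism_norm[OF ta, of "fst p" "circlepath 0 1 (snd p)"] nzt[of "fst p" "snd p"]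
        by (simp add: norm_divide del: complex_cnj_mult)
      then show ?thesis using \<kappa> by (simp add: A_def)
    qed
    have "continuous_on ({0..1} \<times> {0..1}) ?h"
      using nzt by (intro continuous_intros) (auto simp: circlepath_0_cis intro!: continuous_intros)
    then show "continuous_on ({0..1} \<times> {0..1}) (\<lambda>p. F (?h p))"
      by (rule continuous_on_compose2[OF holomorphic_on_imp_continuous_on[OF FA(1)]]) (use hA in auto)
    show "(\<lambda>p. F (?h p)) \<in> {0..1} \<times> {0..1} \<rightarrow> - {0}"
      using FA(2) hA by (intro Pi_I) auto
    show "pathfinish ((\<lambda>p. F (?h p)) \<circ> Pair t) = pathstart ((\<lambda>p. F (?h p)) \<circ> Pair t)" for t
      by (simp add: pathfinish_def pathstart_def circlepath_0_cis)
  qed (auto simp: \<phi>_def)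
  then have n': "Re (winding_number ((F \<circ> \<phi>) \<circ> circlepath 0 1) 0) = n"
    unfolding n_def using winding_number_homotopic_loops by metis
  have tangent: "circle_mean W s \<ge> circle_mean W 1" if s: "0 < s" "s < 1" for s
  proof -
    have "circle_mean W s \<ge> circle_mean W 1 + Re (winding_number ((F \<circ> \<phi>) \<circ> circlepath 0 1) 0) * ln s"
    proof (rule circle_mean_ge_tangent[OF Wc Wh _ \<mu>(1,2)])
      show "(F \<circ> \<phi>) holomorphic_on {z. 1 - \<mu> < cmod z \<and> cmod z < 1 + \<mu>}"
        using FS2 \<mu>(3) holomorphic_on_subset by blast
      show "(F \<circ> \<phi>) z \<noteq> 0 \<and> W z = ln (cmod ((F \<circ> \<phi>) z))"
        if "1 - \<mu> < cmod z" "cmod z < 1 + \<mu>" for z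
        using that \<mu>(3) FA \<phi>A[of z] by (auto simp: W_def)
    qed (use s \<epsilon> in \<open>auto simp: T_def\<close>)
    moreover have "n * ln s \<ge> 0" using n0 s by (simp add: mult_nonpos_nonpos)
    ultimately show ?thesis using n' by simp
  qed
  obtain x0 where x0: "x0 \<in> sphere 0 1" "\<And>x. x \<in> sphere 0 1 \<Longrightarrow> V x0 \<le> V x"
    using continuous_attains_inf[OF compact_sphere _ Vs[of 1]] by fastforce
  define \<delta> where "\<delta> = V x0"
  have \<delta>: "\<delta> > 0" using pos[of x0] x0(1) by (simp add: \<delta>_def)
  have Wsph: "continuous_on (sphere 0 s) W" if "s \<le> 1" for s
    using that \<epsilon> by (intro continuous_on_subset[OF Wc]) (auto simp: T_def)
  have m1: "circle_mean (\<lambda>_. \<delta>) 1 \<le> circle_mean W 1"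
  proof (rule circle_mean_mono)
    fix z :: complex assume "cmod z = 1"
    then have "\<phi> z \<in> sphere 0 1"
      using disc_automorphism_norm[OF a, of z] by (simp add: \<phi>_def norm_divide)
    then show "\<delta> \<le> W z" unfolding \<delta>_def W_def by (rule x0(2))
  qed (use Wsph in auto)
  have "\<phi> 0 = a" by (simp add: \<phi>_def)
  then have W0: "W 0 = 0" using Va by (simp add: W_def)
  have "0 \<in> ball 0 T" using \<epsilon> by (simp add: T_def)
  then obtain d where d: "d > 0" "\<And>z. z \<in> ball 0 T \<Longrightarrow> dist z 0 < d \<Longrightarrow> dist (W z) (W 0) < \<delta>/2"
    using Wc \<delta> half_gt_zero unfolding continuous_on_iff by metis
  define s where "s = min (d/2) (1/2)"
  have s: "0 < s" "s < 1" "s < d" using d(1) by (auto simp: s_def)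
  have "circle_mean W s \<le> circle_mean (\<lambda>_. \<delta>/2) s"
  proof (rule circle_mean_mono)
    fix z :: complex assume "cmod z = s"
    then have "dist (W z) (W 0) < \<delta>/2" using s \<epsilon> by (intro d(2)) (auto simp: T_def)
    then show "W z \<le> \<delta>/2" using W0 by (simp add: dist_real_def)
  qed (use Wsph s in auto)
  then show False using tangent[OF s(1,2)] m1 \<delta> by simp
qed

section \<open>A zero set that meets every circle\<close>

text \<open>
  Equivalent to the bound \<open>n ^ n / fact n \<le> exp n\<close>.
\<close>
lemma sum_ln_ratio_le: "(\<Sum>i=1..n. ln (real n) - ln (real i)) \<le> real n"
proof (induction n)
  case 0 then show ?case by simp
next
  case (Suc n)
  show ?case
  proof (cases "n = 0")
    case False
    have "ln (real (Suc n)) - ln (real n) = ln (1 + 1 / real n)"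
    proof -
      have "1 + 1 / real n = real (Suc n) / real n" using False by (simp add: field_simps)
      then show ?thesis using False by (simp only: ln_div) simp
    qed
    also have "\<dots> \<le> 1 / real n" by (rule ln_add_one_self_le_self) simp
    finally have "real n * (ln (real (Suc n)) - ln (real n)) \<le> real n * (1 / real n)"
      by (rule mult_left_mono) simp
    then have l: "real n * (ln (real (Suc n)) - ln (real n)) \<le> 1"
      using False by simp
    have "(\<Sum>i=1..Suc n. ln (real (Suc n)) - ln (real i)) = (\<Sum>i=1..n. ln (real (Suc n)) - ln (real i))"
      by simp
    also have "\<dots> = (\<Sum>i=1..n. ln (real n) - ln (real i)) + real n * (ln (real (Suc n)) - ln (real n))"
      unfolding sum_subtractf by (simp add: right_diff_distrib)
    also have "\<dots> \<le> real (Suc n)" using Suc l by simp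
    finally show ?thesis .
  qed simp
qed

text \<open>
  This bounds, at one of \<open>n\<close> points with equally spaced moduli, the logarithmic potential of the others by a
  multiple of \<open>n\<close>.
\<close>
lemma sum_ln_spacing_le:
  assumes "k < n"
  shows "(\<Sum>j\<in>{..<n} - {k}. ln (8 * real n / \<bar>real j - real k\<bar>)) \<le> 8 * real n"
proof -
  define L where "L i = ln (8 * real n / real i)" for i
  have n: "n > 0" using assms by simp
  have L0: "L i \<ge> 0" if "i \<in> {1..n}" for i
  proof -
    have "real i \<le> 8 * real n" "0 < real i" using that by auto
    then show ?thesis by (simp add: L_def)
  qed
  have "ln 2 \<le> (1::real)" using ln_le_minus_one[of 2] by simp
  moreover have "ln (8::real) = 3 * ln 2" using ln_realpow[of 2 3] by simp
  ultimately have l8: "ln (8::real) \<le> 3" by simp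
  have "(\<Sum>i=1..n. L i) = (\<Sum>i=1..n. ln 8 + (ln (real n) - ln (real i)))"
  proof (rule sum.cong)
    fix i assume "i \<in> {1..n}"
    then have "real i > 0" "real n > 0" by auto
    then have "L i = ln (8 * real n) - ln (real i)" "ln (8 * real n) = ln 8 + ln (real n)"
      unfolding L_def by (simp_all only: ln_div ln_mult) simp_all
    then show "L i = ln 8 + (ln (real n) - ln (real i))" by simp
  qed simp
  also have "\<dots> = real n * ln 8 + (\<Sum>i=1..n. ln (real n) - ln (real i))"
    unfolding sum.distrib by simp
  also have "\<dots> \<le> real n * 3 + real n"
    using l8 sum_ln_ratio_le[of n] n by (intro add_mono mult_left_mono) auto
  finally have S: "(\<Sum>i=1..n. L i) \<le> 4 * real n" by simp
  have "{..<n} - {k} = {..<k} \<union> {k<..<n}" using assms by auto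
  then have eq: "{..<n} - {k} = {..<k} \<union> {k<..<n}" .
  have disj: "{..<k} \<inter> {k<..<n} = {}" by auto
  have split: "(\<Sum>j\<in>{..<n} - {k}. ln (8 * real n / \<bar>real j - real k\<bar>)) =
      (\<Sum>j\<in>{..<k}. ln (8 * real n / \<bar>real j - real k\<bar>)) + (\<Sum>j\<in>{k<..<n}. ln (8 * real n / \<bar>real j - real k\<bar>))"
    unfolding eq by (rule sum.union_disjoint[OF finite_lessThan finite_greaterThanLessThan disj])
  have "(\<Sum>j\<in>{..<k}. ln (8 * real n / \<bar>real j - real k\<bar>)) = (\<Sum>j\<in>{..<k}. L (k - j))"
    by (intro sum.cong) (auto simp: L_def of_nat_diff)
  also have "\<dots> = (\<Sum>i\<in>(\<lambda>j. k - j) ` {..<k}. L i)"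
    by (subst sum.reindex) (auto simp: inj_on_def)
  also have "\<dots> \<le> (\<Sum>i=1..n. L i)"
    using assms L0 by (intro sum_mono2) auto
  finally have left: "(\<Sum>j\<in>{..<k}. ln (8 * real n / \<bar>real j - real k\<bar>)) \<le> (\<Sum>i=1..n. L i)" .
  have "(\<Sum>j\<in>{k<..<n}. ln (8 * real n / \<bar>real j - real k\<bar>)) = (\<Sum>j\<in>{k<..<n}. L (j - k))"
    by (intro sum.cong) (auto simp: L_def of_nat_diff)
  also have "\<dots> = (\<Sum>i\<in>(\<lambda>j. j - k) ` {k<..<n}. L i)"
    by (subst sum.reindex) (auto simp: inj_on_def)
  also have "\<dots> \<le> (\<Sum>i=1..n. L i)"
    using assms L0 by (intro sum_mono2) auto
  finally show ?thesis using split left S by linarith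
qed

text \<open>
  Choose points \<open>\<zeta>\<^sub>j\<close> with \<open>h (\<zeta>\<^sub>j) \<ge> M\<close> whose moduli are equally spaced in \<open>[1, 2)\<close>, and let \<open>p\<close> be
  the average of the potentials \<open>ln (4 / |z - \<zeta>\<^sub>j|)\<close>. By continuity \<open>h \<ge> M / 2\<close> on the discs of radius
  \<open>\<kappa> = 4 exp (- n)\<close> about the \<open>\<zeta>\<^sub>j\<close>. On the boundary of such a disc its own term contributes 1 to \<open>p\<close>, and
  by the spacing of the moduli the other terms contribute at most 8. On the outer circle \<open>p \<le> 0\<close>. Hence
  \<open>(M / 18) p \<le> h\<close> on the boundary, and then at the centre, where \<open>p \<ge> ln 2\<close>.
\<close>
lemma superharmonic_lower_bound_at_center:
  fixes h :: "complex \<Rightarrow> real"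
  assumes h: "continuous_on (cball 0 8) h" "harmonically_supported (\<lambda>z. - h z) (ball 0 8)"
    "\<And>z. z \<in> cball 0 8 \<Longrightarrow> h z \<ge> 0"
    and thick: "\<And>t. t \<in> {1..2} \<Longrightarrow> \<exists>z. cmod z = t \<and> h z \<ge> M"
  shows "M \<le> 36 * h 0"
proof (cases "M > 0")
  case False then show ?thesis using h(3)[of 0] by simp
next
  case M: True
  have "uniformly_continuous_on (cball 0 8) h"
    using h(1) compact_uniformly_continuous compact_cball by blast
  then obtain \<delta> where \<delta>: "\<delta> > 0"
    "\<And>x y. x \<in> cball 0 8 \<Longrightarrow> y \<in> cball 0 8 \<Longrightarrow> dist y x < \<delta> \<Longrightarrow> dist (h y) (h x) < M / 2"
    using M half_gt_zero unfolding uniformly_continuous_on_def by metis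
  have "((\<lambda>n::nat. 4 * exp (- real n)) \<longlongrightarrow> 0) at_top" by real_asymp
  then have "\<forall>\<^sub>F n in sequentially. 4 * exp (- real n) < min \<delta> 1"
    using \<delta>(1) by (intro order_tendstoD) auto
  moreover have "\<forall>\<^sub>F n in sequentially. 4 * exp (- real n) \<le> 1 / (2 * real n)" by real_asymp
  ultimately have "\<forall>\<^sub>F n in sequentially. n > 0 \<and> 4 * exp (- real n) < min \<delta> 1 \<and>
      4 * exp (- real n) \<le> 1 / (2 * real n)"
    using eventually_gt_at_top[of 0] by eventually_elim auto
  then obtain n where n: "n > 0" "4 * exp (- real n) < min \<delta> 1" "4 * exp (- real n) \<le> 1 / (2 * real n)"
    unfolding eventually_sequentially by blast
  \<comment> \<open>The radius is such that \<open>(1 / n) ln (4 / \<kappa>) = 1\<close>, and \<open>n\<close> is large enough for continuity to apply.\<close>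
  define \<kappa> where "\<kappa> = 4 * exp (- real n)"
  have \<kappa>: "0 < \<kappa>" "\<kappa> < \<delta>" "\<kappa> < 1" "\<kappa> \<le> 1 / (2 * real n)" using n by (auto simp: \<kappa>_def)
  have t12: "1 + real j / real n \<in> {1..2}" if "j < n" for j using that n by auto
  then have "\<forall>j\<in>{..<n}. \<exists>z. cmod z = 1 + real j / real n \<and> h z \<ge> M"
    using thick by auto
  from bchoice[OF this]
  obtain \<zeta> where \<zeta>: "\<And>j. j < n \<Longrightarrow> cmod (\<zeta> j) = 1 + real j / real n" "\<And>j. j < n \<Longrightarrow> h (\<zeta> j) \<ge> M"
    by auto
  have \<zeta>12: "1 \<le> cmod (\<zeta> j)" "cmod (\<zeta> j) \<le> 2" if "j < n" for j
    using t12[OF that] \<zeta>(1)[OF that] by auto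
  define p where "p z = (\<Sum>j<n. (- 1 / real n) * ln (cmod ((z - \<zeta> j) / 4)))" for z
  define q where "q z = (M / 18) * p z + (- h z)" for z
  define K where "K = cball 0 8 - (\<Union>j<n. ball (\<zeta> j) \<kappa>)"
  define G where "G = ball 0 8 - (\<Union>j<n. cball (\<zeta> j) \<kappa>)"
  have dK: "cmod (z - \<zeta> j) \<ge> \<kappa>" if "z \<in> K" "j < n" for z j
    using that by (force simp: K_def dist_norm norm_minus_commute)
  have K: "compact K" unfolding K_def
    by (intro compact_diff) auto
  moreover have "open G" unfolding G_def
    by (intro open_Diff closed_UN) auto
  moreover have GK: "G \<subseteq> K" by (force simp: G_def K_def)
  moreover have "continuous_on K q"
    unfolding q_def p_def using dK \<kappa>(1) continuous_on_subset[OF h(1), of K]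
    by (intro continuous_intros) (force simp: K_def)+
  moreover have "harmonically_supported q G"
  proof -
    have "harmonically_supported (\<lambda>z. (- 1 / real n) * ln (cmod ((z - \<zeta> j) / 4))) G" if "j < n" for j
    proof (rule harmonically_supported_ln_norm[OF \<open>open G\<close>])
      show "(z - \<zeta> j) / 4 \<noteq> 0" if "z \<in> G" for z
        using dK[of z j] GK \<open>z \<in> G\<close> \<open>j < n\<close> \<kappa>(1) by auto
    qed (intro holomorphic_intros, simp)
    then have "harmonically_supported p G"
      unfolding p_def by (intro harmonically_supported_sum) simp
    moreover have "harmonically_supported (\<lambda>z. - h z) G"
      by (rule harmonically_supported_subset[OF h(2)]) (simp add: G_def)
    ultimately show ?thesis
      unfolding q_def using M by (intro harmonically_supported_add harmonically_supported_cmult) auto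
  qed
  moreover have "q z \<le> 0" if z: "z \<in> K - G" for z
  proof -
    have z8: "z \<in> cball 0 8" using z by (auto simp: K_def)
    consider "cmod z = 8" | k where "k < n" "cmod (z - \<zeta> k) = \<kappa>"
      using z by (force simp: K_def G_def dist_norm norm_minus_commute)
    then show ?thesis
    proof cases
      case 1
      have "(- 1 / real n) * ln (cmod ((z - \<zeta> j) / 4)) \<le> 0" if "j < n" for j
      proof -
        have "cmod (z - \<zeta> j) \<ge> 6"
          using 1 \<zeta>12[OF that] norm_triangle_ineq2[of z "\<zeta> j"] by simp
        then show ?thesis by (simp add: norm_divide)
      qed
      then have "p z \<le> 0" unfolding p_def by (intro sum_nonpos) auto
      then have "(M / 18) * p z \<le> 0" using M by (intro mult_nonneg_nonpos) auto
      then show ?thesis using h(3)[OF z8] unfolding q_def by linarith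
    next
      case (2 k)
      have lnk: "(- 1 / real n) * ln (cmod ((z - \<zeta> k) / 4)) = 1"
        using 2 n(1) by (simp add: norm_divide \<kappa>_def)
      have "(- 1 / real n) * ln (cmod ((z - \<zeta> j) / 4)) \<le> (1 / real n) * ln (8 * real n / \<bar>real j - real k\<bar>)"
        if j: "j \<in> {..<n} - {k}" for j
      proof -
        have jk: "\<bar>real j - real k\<bar> \<ge> 1" using j by (cases "j < k") auto
        have "cmod (\<zeta> k - \<zeta> j) \<ge> \<bar>real j - real k\<bar> / real n"
          using norm_triangle_ineq3[of "\<zeta> k" "\<zeta> j"] \<zeta>(1)[of j] \<zeta>(1)[of k] j 2 n(1)
          by (simp add: diff_divide_distrib[symmetric] abs_minus_commute)
        moreover have "cmod (\<zeta> k - \<zeta> j) \<le> cmod (z - \<zeta> j) + \<kappa>"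
          using norm_triangle_ineq[of "z - \<zeta> j" "\<zeta> k - z"] 2 by (simp add: norm_minus_commute)
        moreover have "\<kappa> \<le> \<bar>real j - real k\<bar> / (2 * real n)"
          using \<kappa>(4) jk by (rule_tac order_trans) (auto intro!: divide_right_mono)
        ultimately have "cmod (z - \<zeta> j) \<ge> \<bar>real j - real k\<bar> / (2 * real n)"
          by (simp add: field_simps)
        then have "4 / cmod (z - \<zeta> j) \<le> 4 / (\<bar>real j - real k\<bar> / (2 * real n))"
          using jk n(1) dK[of z j] z j \<kappa>(1)
          by (intro divide_left_mono mult_pos_pos divide_pos_pos) auto
        then have "ln (4 / cmod (z - \<zeta> j)) \<le> ln (8 * real n / \<bar>real j - real k\<bar>)"
          using jk n(1) dK[of z j] z j \<kappa>(1) by (subst ln_le_cancel_iff) auto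
        moreover have "cmod (z - \<zeta> j) > 0" using dK[of z j] z j \<kappa>(1) by auto
        then have "ln (4 / cmod (z - \<zeta> j)) = - ln (cmod ((z - \<zeta> j) / 4))"
          by (simp add: ln_div norm_divide)
        ultimately show ?thesis using n(1) by (simp add: field_simps)
      qed
      then have "(\<Sum>j\<in>{..<n} - {k}. (- 1 / real n) * ln (cmod ((z - \<zeta> j) / 4)))
          \<le> (\<Sum>j\<in>{..<n} - {k}. (1 / real n) * ln (8 * real n / \<bar>real j - real k\<bar>))"
        by (rule sum_mono)
      also have "\<dots> = (1 / real n) * (\<Sum>j\<in>{..<n} - {k}. ln (8 * real n / \<bar>real j - real k\<bar>))"
        by (simp only: sum_distrib_left)
      also have "\<dots> \<le> (1 / real n) * (8 * real n)"
        using sum_ln_spacing_le[OF 2(1)] n(1) by (intro mult_left_mono) auto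
      also have "\<dots> = 8" using n(1) by simp
      finally have "p z \<le> 9"
        using lnk 2(1) unfolding p_def by (subst sum.remove[of _ k]) auto
      moreover have "h z \<ge> M / 2"
      proof -
        have "dist (h z) (h (\<zeta> k)) < M / 2"
          using 2 z8 \<kappa>(2) \<zeta>12[OF 2(1)] by (intro \<delta>(2)) (auto simp: dist_norm)
        then show ?thesis using \<zeta>(2)[OF 2(1)] unfolding dist_real_def by linarith
      qed
      moreover have "(M / 18) * p z \<le> (M / 18) * 9"
        using M \<open>p z \<le> 9\<close> by (intro mult_left_mono) auto
      ultimately show ?thesis unfolding q_def by linarith
    qed
  qed
  moreover have "0 \<in> K"
    using \<zeta>12(1) \<kappa>(3) by (force simp: K_def)
  ultimately have "q 0 \<le> 0" by (rule harmonically_supported_maximum_principle)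
  moreover have "p 0 \<ge> 1 / 2"
  proof -
    have "1 / real n * (1/2) \<le> (- 1 / real n) * ln (cmod ((0 - \<zeta> j) / 4))" if "j \<in> {..<n}" for j
    proof -
      have l: "1 \<le> cmod (\<zeta> j)" "cmod (\<zeta> j) \<le> 2" using \<zeta>12 that by auto
      have "ln (cmod (\<zeta> j)) \<le> ln 2" using l by (subst ln_le_cancel_iff) auto
      moreover have "ln (4::real) = 2 * ln 2" using ln_realpow[of 2 2] by simp
      moreover have "ln (cmod ((0 - \<zeta> j) / 4)) = ln (cmod (\<zeta> j)) - ln 4"
        using l by (auto simp: norm_divide ln_div)
      ultimately have "ln (cmod ((0 - \<zeta> j) / 4)) \<le> - (1/2)"
        using ln2_ge_two_thirds by linarith
      then show ?thesis using n(1) by (simp add: field_simps)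
    qed
    then have "(\<Sum>j<n. 1 / real n * (1/2)) \<le> p 0" unfolding p_def by (rule sum_mono)
    then show ?thesis using n(1) by simp
  qed
  then have "(M / 18) * (1/2) \<le> (M / 18) * p 0" using M by (intro mult_left_mono) auto
  ultimately show ?thesis unfolding q_def by simp
qed

section \<open>Positivity on a disc\<close>

text \<open>
  Either \<open>V\<close> is positive on some circle of radius in \<open>[1, 2]\<close>, and rescaling makes it the unit circle, or the
  zeros of \<open>V\<close> meet all these circles. In the second case \<open>Re G + \<eta> - V\<close> is nonnegative, equals \<open>\<eta>\<close> at the
  centre, and is at least 36 at the zeros of \<open>V\<close>.
\<close>
theorem positive_on_disc_of_small_excess:
  fixes V :: "complex \<Rightarrow> real"
  assumes V: "continuous_on (ball 0 9) V" "harmonically_supported V (ball 0 9)"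
    "\<And>z. z \<in> ball 0 9 \<Longrightarrow> V z \<ge> 0"
    and F: "F holomorphic_on {z \<in> ball 0 9. V z > 0}"
      "\<And>z. z \<in> ball 0 9 \<Longrightarrow> V z > 0 \<Longrightarrow> F z \<noteq> 0 \<and> V z = ln (cmod (F z))"
    and G: "G holomorphic_on ball 0 9" "\<And>z. z \<in> ball 0 9 \<Longrightarrow> V z \<le> Re (G z) + \<eta>"
      "V 0 = Re (G 0)" "\<And>z. z \<in> ball 0 9 \<Longrightarrow> Re (G z) + \<eta> \<ge> 36" and \<eta>: "\<eta> < 1"
    and z: "cmod z < 1"
  shows "V z > 0"
proof (cases "\<exists>t\<in>{1..2}. \<forall>w. cmod w = t \<longrightarrow> V w > 0")
  case True
  then obtain t where t: "1 \<le> t" "t \<le> 2" "\<And>w. cmod w = t \<Longrightarrow> V w > 0" by auto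
  define m where "m w = of_real t * w" for w :: complex
  have m9: "m w \<in> ball 0 9" if "w \<in> ball 0 4" for w
  proof -
    have "t * cmod w \<le> 2 * 4" using that t by (intro mult_mono) auto
    then show ?thesis using t by (simp add: m_def norm_mult)
  qed
  have holm: "m holomorphic_on S" for S unfolding m_def by (intro holomorphic_intros)
  have contm: "continuous_on S m" for S unfolding m_def by (intro continuous_intros)
  have cV: "continuous_on (ball 0 4) (\<lambda>w. V (m w))"
    by (rule continuous_on_compose2[OF V(1) contm]) (use m9 in auto)
  have "open (ball 0 4 \<inter> (\<lambda>w. V (m w)) -` {0<..})"
    using cV by (intro continuous_open_preimage) auto
  moreover have "sphere 0 1 \<subseteq> ball 0 4 \<inter> (\<lambda>w. V (m w)) -` {0<..}"
    using t by (auto simp: m_def norm_mult)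
  ultimately obtain \<kappa> where \<kappa>: "0 < \<kappa>" "\<kappa> \<le> 1"
      "{w. 1 - \<kappa> < cmod w \<and> cmod w < 1 + \<kappa>} \<subseteq> ball 0 4 \<inter> (\<lambda>w. V (m w)) -` {0<..}"
    by (rule annulus_subset_open)
  have "V (m (z / of_real t)) > 0"
  proof (rule positive_inside_isolating_circle[where V = "\<lambda>w. V (m w)" and F = "F \<circ> m" and G = "G \<circ> m"
        and \<kappa> = \<kappa> and \<eta> = \<eta>, OF cV])
    show "harmonically_supported (\<lambda>w. V (m w)) (ball 0 4)"
      by (rule harmonically_supported_compose[OF V(2) _ holm]) (use m9 in auto)
    show "(F \<circ> m) holomorphic_on {w. 1 - \<kappa> < cmod w \<and> cmod w < 1 + \<kappa>}"
      by (rule holomorphic_on_compose_gen[OF holm F(1)]) (use \<kappa>(3) m9 in auto)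
    show "(F \<circ> m) w \<noteq> 0 \<and> V (m w) = ln (cmod ((F \<circ> m) w))"
      if "1 - \<kappa> < cmod w" "cmod w < 1 + \<kappa>" for w
    proof -
      have "w \<in> ball 0 4 \<inter> (\<lambda>w. V (m w)) -` {0<..}" using \<kappa>(3) that by blast
      then show ?thesis using F(2)[of "m w"] m9[of w] by auto
    qed
    show "(G \<circ> m) holomorphic_on ball 0 4"
      by (rule holomorphic_on_compose_gen[OF holm G(1)]) (use m9 in auto)
    show "V (m w) > 0" if "cmod w = 1" for w using t that by (simp add: m_def norm_mult)
    show "cmod (z / of_real t) < 1" using z t by (simp add: norm_divide divide_simps)
  qed (use V(3) G(2,3) m9 \<kappa> \<eta> in \<open>auto simp: m_def\<close>)
  then show ?thesis using t by (simp add: m_def)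
next
  case False
  define h where "h w = Re (G w) + \<eta> - V w" for w
  have "36 \<le> 36 * h 0"
  proof (rule superharmonic_lower_bound_at_center)
    show "continuous_on (cball 0 8) h" unfolding h_def
      by (intro continuous_intros continuous_on_subset[OF V(1)]
          continuous_on_subset[OF holomorphic_on_imp_continuous_on[OF G(1)]]) auto
    have "harmonically_supported (\<lambda>w. V w + Re (- G w - of_real \<eta>)) (ball 0 8)"
      using G(1)
      by (intro harmonically_supported_add harmonically_supported_Re
          harmonically_supported_subset[OF V(2)]) (auto intro!: holomorphic_intros)
    then show "harmonically_supported (\<lambda>w. - h w) (ball 0 8)"
      by (simp add: h_def algebra_simps)
    show "h w \<ge> 0" if "w \<in> cball 0 8" for w using G(2)[of w] that by (simp add: h_def)
    show "\<exists>w. cmod w = s \<and> h w \<ge> 36" if s: "s \<in> {1..2}" for s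
    proof -
      obtain w where w: "cmod w = s" "V w \<le> 0" using False s by force
      then show ?thesis using G(4)[of w] s by (intro exI[of _ w]) (auto simp: h_def)
    qed
  qed
  then show ?thesis using G(3) \<eta> by (simp add: h_def)
qed

section \<open>Direct tracts\<close>

text \<open>
  Near a pole \<open>|f|\<close> is large, so it is harmless that \<open>f\<close> takes the value 0 at the pole itself.
\<close>
lemma direct_tract_open:
  assumes mero: "f nicely_meromorphic_on ball 0 1"
  shows "open {z \<in> ball 0 1. is_pole f z \<or> R < cmod (f z)}" (is "open ?S")
proof (subst open_subopen, intro ballI)
  fix z assume z: "z \<in> ?S"
  have "\<forall>\<^sub>F w in at z. R < cmod (f w)"
  proof (cases "is_pole f z")
    case True
    then have "filterlim (\<lambda>w. cmod (f w)) at_top (at z)"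
      unfolding is_pole_def by (rule filterlim_at_infinity_imp_norm_at_top)
    then show ?thesis by (simp add: filterlim_at_top_dense)
  next
    case False
    then have "f analytic_on {z}"
      using nicely_meromorphic_on_imp_analytic_at[OF mero] z by auto
    then have "isCont f z" by (rule analytic_at_imp_isCont)
    then have "((\<lambda>w. cmod (f w)) \<longlongrightarrow> cmod (f z)) (at z)"
      unfolding isCont_def by (rule tendsto_norm)
    then show ?thesis using z False by (intro order_tendstoD) auto
  qed
  then have "\<forall>\<^sub>F w in nhds z. w \<noteq> z \<longrightarrow> R < cmod (f w)"
    by (simp add: eventually_at_filter)
  moreover have "\<forall>\<^sub>F w in nhds z. w \<in> ball 0 1"
    using z by (intro eventually_nhds_in_open) auto
  ultimately have "\<forall>\<^sub>F w in nhds z. w \<in> ?S"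
    by eventually_elim (use z in blast)
  then show "\<exists>T. open T \<and> z \<in> T \<and> T \<subseteq> ?S"
    unfolding eventually_nhds by blast
qed

locale meromorphic_tract =
  fixes f :: "complex \<Rightarrow> complex" and R :: real and U :: "complex set"
  assumes mero: "f nicely_meromorphic_on ball 0 1" and tract: "direct_tract f R U"
begin

abbreviation "v \<equiv> tract_fun f R U"
abbreviation "S \<equiv> {z \<in> ball 0 1. is_pole f z \<or> R < cmod (f z)}"

lemma R_pos: "R > 0" and U_component: "U \<in> components S"
  using tract by (auto simp: direct_tract_def)

lemma U_subset: "U \<subseteq> S" using in_components_subset[OF U_component] .

lemma no_pole: "z \<in> U \<Longrightarrow> \<not> is_pole f z" using tract by (auto simp: direct_tract_def)

lemma open_U: "open U"
  using open_components[OF direct_tract_open[OF mero]] U_component by blast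

lemma U_ball: "U \<subseteq> ball 0 1" using U_subset by blast

lemma large_on_U: "z \<in> U \<Longrightarrow> R < cmod (f z)" using U_subset no_pole by blast

lemma analytic: "z \<in> ball 0 1 \<Longrightarrow> \<not> is_pole f z \<Longrightarrow> f analytic_on {z}"
  using nicely_meromorphic_on_imp_analytic_at[OF mero] by auto

lemma holomorphic_U: "f holomorphic_on U"
  using analytic no_pole U_ball analytic_imp_holomorphic analytic_on_analytic_at by (metis subsetD)

lemma tract_fun_eq: "z \<in> U \<Longrightarrow> v z = ln (cmod (f z / of_real R))"
  by (simp add: tract_fun_def)

lemma tract_fun_pos_iff: "v z > 0 \<longleftrightarrow> z \<in> U"
  using large_on_U[of z] R_pos by (auto simp: tract_fun_def norm_divide intro!: ln_gt_zero)

lemma tract_fun_nonneg: "v z \<ge> 0"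
  using tract_fun_pos_iff[of z] by (cases "z \<in> U") (simp_all add: tract_fun_def less_imp_le)

lemma tract_fun_zero: "z \<notin> U \<Longrightarrow> v z = 0"
  by (simp add: tract_fun_def)

lemma continuous_tract_fun: "continuous_on (ball 0 1) v"
  unfolding continuous_on_eq_continuous_at[OF open_ball]
proof
  fix z :: complex assume z: "z \<in> ball 0 1"
  consider "z \<in> U" | "z \<in> S" "z \<notin> U" | "z \<notin> S" by blast
  then show "isCont v z"
  proof cases
    case 1
    then have "isCont f z" using analytic[OF z] no_pole analytic_at_imp_isCont by blast
    then have "isCont (\<lambda>w. ln (cmod (f w / of_real R))) z"
      using large_on_U[OF 1] R_pos by (intro continuous_intros) auto
    moreover have "\<forall>\<^sub>F w in nhds z. v w = ln (cmod (f w / of_real R))"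
      using eventually_nhds_in_open[OF open_U 1] by eventually_elim (rule tract_fun_eq)
    ultimately show ?thesis by (simp add: isCont_cong)
  next
    case 2
    define W where "W = connected_component_set S z"
    have W: "W \<in> components S" unfolding W_def by (rule componentsI[OF 2(1)])
    have zW: "z \<in> W" using 2(1) connected_component_refl[of z S] unfolding W_def by simp
    then have "W \<inter> U = {}" using components_nonoverlap[OF W U_component] 2(2) by blast
    then have "\<forall>w\<in>W. v w = 0" using tract_fun_zero by blast
    moreover have "open W" using open_components[OF direct_tract_open[OF mero]] W by blast
    ultimately have "\<forall>\<^sub>F w in nhds z. v w = 0"
      using eventually_nhds_in_open[of W z] zW by (auto elim: eventually_mono)
    then show ?thesis by (simp add: isCont_cong)
  next
    case 3
    then have fz: "\<not> is_pole f z" "cmod (f z) \<le> R" using z by auto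
    then have zU: "z \<notin> U" using large_on_U by fastforce
    have "isCont f z" using analytic[OF z] fz analytic_at_imp_isCont by blast
    then have "isCont (\<lambda>w. ln (max 1 (cmod (f w / of_real R)))) z"
      using R_pos by (intro continuous_intros) auto
    moreover have "ln (max 1 (cmod (f z / of_real R))) = 0"
      using fz(2) R_pos by (simp add: norm_divide)
    ultimately have lim: "((\<lambda>w. ln (max 1 (cmod (f w / of_real R)))) \<longlongrightarrow> 0) (at z)"
      by (simp add: isCont_def)
    have "v w \<le> ln (max 1 (cmod (f w / of_real R)))" for w
    proof (cases "w \<in> U")
      case True
      then have "1 \<le> cmod (f w / of_real R)" using large_on_U[of w] R_pos by (simp add: norm_divide)
      then show ?thesis using tract_fun_eq[OF True] by (simp add: max_def)
    qed (simp add: tract_fun_zero)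
    then have "(v \<longlongrightarrow> 0) (at z)"
      by (intro tendsto_sandwich[OF _ _ tendsto_const lim]) (auto simp: tract_fun_nonneg)
    then show ?thesis using tract_fun_zero[OF zU] by (simp add: isCont_def)
  qed
qed

lemma harmonically_supported_tract_fun: "harmonically_supported v (ball 0 1)"
  unfolding harmonically_supported_def
proof
  fix z :: complex assume z: "z \<in> ball 0 1"
  show "\<exists>e>0. \<exists>g. g holomorphic_on ball z e \<and> (\<forall>w\<in>ball z e. Re (g w) \<le> v w) \<and> Re (g z) = v z"
  proof (cases "z \<in> U")
    case False
    then show ?thesis
      by (intro exI[of _ 1] conjI exI[of _ "\<lambda>_. 0"]) (auto simp: tract_fun_zero tract_fun_nonneg)
  next
    case True
    have "harmonically_supported (\<lambda>z. 1 * ln (cmod (f z / of_real R))) U"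
      using holomorphic_U large_on_U R_pos
      by (intro harmonically_supported_ln_norm open_U) (force intro!: holomorphic_intros)+
    from harmonically_supportedE[OF this True] obtain e g where
      g: "e > 0" "g holomorphic_on ball z e"
        "\<And>w. w \<in> ball z e \<Longrightarrow> Re (g w) \<le> 1 * ln (cmod (f w / of_real R))"
        "Re (g z) = 1 * ln (cmod (f z / of_real R))" by metis
    obtain d where d: "d > 0" "ball z d \<subseteq> U" using open_U True open_contains_ball by blast
    show ?thesis
      using g d True
      by (intro exI[of _ "min e d"] conjI exI[of _ g])
         (auto simp: tract_fun_eq subset_iff intro: holomorphic_on_subset)
  qed
qed

lemma tract_fun_unbounded: "\<exists>z\<in>ball 0 1. v z > b"
proof (rule ccontr)
  assume "\<not> ?thesis"
  then have le: "v z \<le> b" if "z \<in> U" for z using that U_ball by force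
  have "cmod (f z) \<le> R * exp b" if "z \<in> U" for z
  proof -
    have "cmod (f z) / R > 0"
      using large_on_U[OF that] R_pos by (intro divide_pos_pos) auto
    moreover have "ln (cmod (f z) / R) \<le> b"
      using le[OF that] tract_fun_eq[OF that] R_pos by (simp add: norm_divide)
    ultimately have "cmod (f z) / R \<le> exp b" by (metis exp_le_cancel_iff exp_ln)
    then show ?thesis using R_pos by (simp add: field_simps)
  qed
  then have "bounded (f ` U)" by (auto simp: bounded_iff)
  then show False using tract by (simp add: direct_tract_def)
qed

end

section \<open>Convexity of the maximum\<close>

text \<open>
  The difference quotients at \<open>x\<close> increase, so the right derivative exists as the infimum of the quotients to the
  right of \<open>x\<close>, and it is at least every quotient to the left.
\<close>
lemma convex_on_right_derivative_support:
  fixes \<phi> :: "real \<Rightarrow> real"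
  assumes \<phi>: "convex_on I \<phi>" and I: "open I" and x: "x \<in> I" and y: "y \<in> I"
  shows "\<phi> y \<ge> \<phi> x + vector_derivative \<phi> (at_right x) * (y - x)"
proof -
  define q where "q t = (\<phi> t - \<phi> x) / (t - x)" for t
  have q_eq: "q t = (\<phi> x - \<phi> t) / (x - t)" for t
    unfolding q_def by (metis minus_diff_eq minus_divide_divide)
  have right_mono: "q t1 \<le> q t2" if "t2 \<in> I" "x < t1" "t1 < t2" for t1 t2
    using convex_on_slope_le(1)[OF \<phi> x that] by (simp add: q_eq)
  have left_right: "q t1 \<le> q t2" if "t1 \<in> I" "t2 \<in> I" "t1 < x" "x < t2" for t1 t2
  proof -
    have "(\<phi> t1 - \<phi> x) / (t1 - x) \<le> (\<phi> x - \<phi> t2) / (x - t2)"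
      using convex_on_slope_le[OF \<phi> that] by linarith
    then show ?thesis by (simp add: q_eq[of t2]) (simp add: q_def)
  qed
  obtain d where d: "d > 0" "ball x d \<subseteq> I" using I x open_contains_ball by blast
  have Il: "x - d / 2 \<in> I" and Ir: "x + d / 2 \<in> I" using d by (auto simp: dist_real_def)
  define A where "A = q ` {t \<in> I. x < t}"
  have Ane: "A \<noteq> {}" using Ir d(1) by (auto simp: A_def)
  have Abd: "bdd_below A"
    using left_right[OF Il _] d(1) by (auto simp: A_def bdd_below_def)
  define L where "L = Inf A"
  have Lle: "L \<le> q t" if "t \<in> I" "x < t" for t
    unfolding L_def using that Abd by (intro cInf_lower) (auto simp: A_def)
  have Lge: "q t \<le> L" if "t \<in> I" "t < x" for t
    unfolding L_def using Ane left_right that by (intro cInf_greatest) (auto simp: A_def)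
  have "(q \<longlongrightarrow> L) (at_right x)"
  proof (rule order_tendstoI)
    fix c assume c: "c < L"
    have "\<forall>\<^sub>F t in at_right x. t \<in> {x<..<x + d}"
      using d(1) by (intro eventually_at_right_real) auto
    then show "\<forall>\<^sub>F t in at_right x. c < q t"
    proof eventually_elim
      case (elim t)
      then have "t \<in> I" using d(2) by (auto simp: dist_real_def subset_iff)
      then show ?case using Lle[of t] elim c by auto
    qed
  next
    fix c assume "L < c"
    then obtain t1 where t1: "t1 \<in> I" "x < t1" "q t1 < c"
      using cInf_lessD[OF Ane] unfolding L_def A_def by blast
    have "\<forall>\<^sub>F t in at_right x. t \<in> {x<..<t1}"
      using t1(2) by (rule eventually_at_right_real)
    then show "\<forall>\<^sub>F t in at_right x. q t < c"
      by eventually_elim (use right_mono[OF t1(1)] t1(3) in force)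
  qed
  then have "(\<phi> has_real_derivative L) (at_right x)"
    unfolding has_field_derivative_iff q_def .
  then have "vector_derivative \<phi> (at_right x) = L"
    by (intro vector_derivative_within)
       (auto simp: has_real_derivative_iff_has_vector_derivative trivial_limit_at_right_real)
  moreover have "\<phi> y \<ge> \<phi> x + L * (y - x)"
  proof (cases y x rule: linorder_cases)
    case less
    then have "(\<phi> x - \<phi> y) \<le> L * (x - y)" using Lge[OF y] by (simp add: q_eq divide_le_eq)
    then show ?thesis by (simp add: algebra_simps)
  next
    case greater
    then have "L * (y - x) \<le> \<phi> y - \<phi> x" using Lle[OF y] by (simp add: q_def le_divide_eq)
    then show ?thesis by (simp add: algebra_simps)
  qed simp
  ultimately show ?thesis by simp
qed

context meromorphic_tract
begin

abbreviation "B \<equiv> circle_max v"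
abbreviation "a \<equiv> log_slope v"

lemma tract_fun_le_circle_max:
  assumes "cmod z < 1"
  shows "v z \<le> B (cmod z)"
proof -
  have "continuous_on (sphere 0 (cmod z)) v"
    using assms by (intro continuous_on_subset[OF continuous_tract_fun]) auto
  then have "bdd_above (v ` sphere 0 (cmod z))"
    by (intro bounded_imp_bdd_above compact_imp_bounded compact_continuous_image) auto
  then show ?thesis unfolding circle_max_def by (intro cSUP_upper) auto
qed

lemma circle_max_three_circles:
  assumes s: "0 < s1" "s1 < s" "s < s2" "s2 < 1"
  shows "B s \<le> B s1 + (B s2 - B s1) * ((ln s - ln s1) / (ln s2 - ln s1))"
  unfolding circle_max_def[of v s]
proof (rule cSUP_least)
  fix z :: complex assume z: "z \<in> sphere 0 s"
  show "v z \<le> B s1 + (B s2 - B s1) * ((ln s - ln s1) / (ln s2 - ln s1))"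
  proof (rule harmonically_supported_three_circles[OF s(1-3)])
    show "continuous_on {z. s1 \<le> cmod z \<and> cmod z \<le> s2} v"
      using s by (intro continuous_on_subset[OF continuous_tract_fun]) auto
    show "harmonically_supported v {z. s1 < cmod z \<and> cmod z < s2}"
      using s by (intro harmonically_supported_subset[OF harmonically_supported_tract_fun]) auto
  qed (use s z tract_fun_le_circle_max in auto)
qed (use s in \<open>auto intro!: exI[of _ "of_real s"]\<close>)

lemma circle_max_support:
  assumes "0 < r" "r < 1" "0 < s" "s < 1"
  shows "B s \<ge> B r + a r * (ln s - ln r)"
proof -
  have "convex_on {..<ln 1} (\<lambda>t. B (exp t))"
    by (rule convex_on_of_three_circles[OF zero_less_one circle_max_three_circles])
  then show ?thesis
    using convex_on_right_derivative_support[of "{..<0}" "\<lambda>t. B (exp t)" "ln r" "ln s"] assms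
    by (simp add: log_slope_def)
qed

lemma log_slope_mono:
  assumes "0 < r" "r \<le> s" "s < 1"
  shows "a r \<le> a s"
proof (cases "r = s")
  case False
  then have "ln s - ln r > 0" using assms by simp
  moreover have "(a s - a r) * (ln s - ln r) \<ge> 0"
    using circle_max_support[of r s] circle_max_support[of s r] assms False
    by (simp add: algebra_simps)
  ultimately show ?thesis by (simp add: zero_le_mult_iff)
qed simp

lemma circle_max_unbounded:
  assumes r0: "0 < r0" "r0 < 1"
  shows "\<exists>r\<in>{r0..<1}. B r > b"
proof -
  have "continuous_on (cball 0 r0) v"
    using r0 by (intro continuous_on_subset[OF continuous_tract_fun]) auto
  then have "bdd_above (v ` cball 0 r0)"
    by (intro bounded_imp_bdd_above compact_imp_bounded compact_continuous_image) auto
  then obtain c where c: "\<And>z. z \<in> cball 0 r0 \<Longrightarrow> v z \<le> c"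
    unfolding bdd_above_def by blast
  obtain z where z: "z \<in> ball 0 1" "v z > max b c" using tract_fun_unbounded by blast
  then have "\<not> z \<in> cball 0 r0" using c by fastforce
  moreover have "B (cmod z) > b" using tract_fun_le_circle_max[of z] z by simp
  ultimately show ?thesis using z(1) by (intro bexI[of _ "cmod z"]) auto
qed

lemma log_slope_unbounded:
  assumes r0: "0 < r0" "r0 < 1"
  shows "\<exists>r\<in>{r0..<1}. a r \<ge> K"
proof (rule ccontr)
  assume neg: "\<not> ?thesis"
  obtain r where r: "r \<in> {r0..<1}" "B r > B r0 + max K 0 * (- ln r0)"
    using circle_max_unbounded[OF r0] by blast
  have "B r \<le> B r0 + a r * (ln r - ln r0)"
    using circle_max_support[of r r0] r0 r(1) by (simp add: algebra_simps)
  also have "a r * (ln r - ln r0) \<le> max K 0 * (ln r - ln r0)"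
    using neg r r0 by (intro mult_right_mono) force+
  also have "\<dots> \<le> max K 0 * (- ln r0)"
    using r r0 by (intro mult_left_mono) auto
  finally show False using r(2) by simp
qed

lemma circle_max_eventually_ge:
  assumes r0: "0 < r0" "r0 < 1" and a: "\<And>r. r0 \<le> r \<Longrightarrow> r < 1 \<Longrightarrow> a r \<ge> 0"
  shows "\<exists>r1\<in>{r0..<1}. \<forall>r. r1 \<le> r \<and> r < 1 \<longrightarrow> B r \<ge> b"
proof -
  obtain r1 where r1: "r1 \<in> {r0..<1}" "B r1 > b" using circle_max_unbounded[OF r0] by blast
  have "B r \<ge> b" if r: "r1 \<le> r" "r < 1" for r
  proof -
    have "a r1 * (ln r - ln r1) \<ge> 0"
      using a[of r1] r1 r r0 by (intro mult_nonneg_nonneg) auto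
    then show ?thesis using circle_max_support[of r1 r] r1 r r0 by auto
  qed
  then show ?thesis using r1 by blast
qed

end

section \<open>The exceptional set\<close>

text \<open>
  By Cauchy condensation, compared with the series of \<open>n powr - (1 + \<delta>)\<close>. The series is shifted by one because
  the term at 1 is 0, which breaks monotonicity there.
\<close>
lemma summable_inverse_ln_powr:
  fixes \<delta> :: real
  assumes \<delta>: "\<delta> > 0"
  shows "summable (\<lambda>n. 1 / (real n * ln (real n) powr (1 + \<delta>)))"
proof -
  define g where "g n = 1 / (real n * ln (real n) powr (1 + \<delta>))" for n
  have "summable (\<lambda>n. g (Suc n))"
  proof (subst condensation_test)
    show "g (Suc (Suc m)) \<le> g (Suc m)" if m: "0 < m" for m
    proof -
      have "ln (real (Suc m)) > 0" using m by simp
      moreover have "ln (real (Suc m)) \<le> ln (real (Suc (Suc m)))" by simp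
      ultimately have "ln (real (Suc m)) powr (1 + \<delta>) \<le> ln (real (Suc (Suc m))) powr (1 + \<delta>)"
        using \<delta> by (intro powr_mono2) auto
      moreover have "ln (real (Suc m)) powr (1 + \<delta>) > 0" using m by simp
      ultimately show ?thesis unfolding g_def
        by (intro divide_left_mono mult_mono mult_pos_pos) auto
    qed
    show "0 \<le> g (Suc n)" for n unfolding g_def by simp
    show "summable (\<lambda>n. 2 ^ n * g (Suc (2 ^ n)))"
    proof (rule summable_comparison_test_ev)
      have "summable (\<lambda>n. ln 2 powr (- (1 + \<delta>)) * (real n powr (- (1 + \<delta>))))"
        using \<delta> by (intro summable_mult) (simp add: summable_real_powr_iff)
      then show "summable (\<lambda>n. (real n * ln 2) powr (- (1 + \<delta>)))"
        by (simp add: powr_mult mult.commute)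
      show "\<forall>\<^sub>F n in sequentially. norm (2 ^ n * g (Suc (2 ^ n))) \<le> (real n * ln 2) powr (- (1 + \<delta>))"
        using eventually_gt_at_top[of 0]
      proof eventually_elim
        case (elim n)
        have "real n * ln 2 = ln (2 ^ n)" by (simp add: ln_realpow)
        also have "\<dots> \<le> ln (real (Suc (2 ^ n)))" by (rule ln_mono) auto
        finally have "(real n * ln 2) powr (1 + \<delta>) \<le> ln (real (Suc (2 ^ n))) powr (1 + \<delta>)"
          using \<delta> by (intro powr_mono2) auto
        moreover have "(2::real) ^ n \<le> real (Suc (2 ^ n))" by simp
        ultimately have le: "2 ^ n * (real n * ln 2) powr (1 + \<delta>)
            \<le> real (Suc (2 ^ n)) * ln (real (Suc (2 ^ n))) powr (1 + \<delta>)"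
          by (intro mult_mono) auto
        have "2 ^ n * (real n * ln 2) powr (1 + \<delta>) > 0" using elim by simp
        then have "g (Suc (2 ^ n)) \<le> 1 / (2 ^ n * (real n * ln 2) powr (1 + \<delta>))"
          unfolding g_def by (intro frac_le le) auto
        then have "2 ^ n * g (Suc (2 ^ n)) \<le> 2 ^ n * (1 / (2 ^ n * (real n * ln 2) powr (1 + \<delta>)))"
          by (intro mult_left_mono) auto
        also have "\<dots> = (real n * ln 2) powr (- (1 + \<delta>))"
          by (simp only: powr_minus) (simp add: field_simps)
        finally show ?case by (simp add: g_def)
      qed
    qed
  qed
  then show ?thesis unfolding summable_Suc_iff by (simp add: g_def[abs_def])
qed

text \<open>
  Applied with \<open>p = 1 / \<beta>\<close>, this turns the control of \<open>a powr \<beta>\<close> into control of \<open>a\<close>.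
\<close>
lemma powr_diff_le_consecutive:
  fixes x y p :: real
  assumes n: "0 < n" and p: "1 \<le> p"
    and x: "real n \<le> x" "x < real n + 1" and y: "real n \<le> y" "y < real n + 1"
  shows "\<bar>x powr p - y powr p\<bar> \<le> p * 2 powr (p - 1) * y powr (p - 1)"
proof -
  have "\<exists>\<xi>. real n < \<xi> \<and> \<xi> < real n + 1 \<and>
      (real n + 1) powr p - real n powr p = (real n + 1 - real n) * (p * \<xi> powr (p - 1))"
    using n by (intro MVT2) (auto intro!: derivative_eq_intros)
  then obtain \<xi> where \<xi>: "real n < \<xi>" "\<xi> < real n + 1"
    "(real n + 1) powr p - real n powr p = p * \<xi> powr (p - 1)" by auto
  have "\<xi> powr (p - 1) \<le> (2 * y) powr (p - 1)"
    using \<xi> n p y by (intro powr_mono2) auto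
  also have "\<dots> = 2 powr (p - 1) * y powr (p - 1)" using y n by (simp add: powr_mult)
  finally have "p * \<xi> powr (p - 1) \<le> p * (2 powr (p - 1) * y powr (p - 1))"
    using p by (intro mult_left_mono) auto
  then have d: "(real n + 1) powr p - real n powr p \<le> p * 2 powr (p - 1) * y powr (p - 1)"
    using \<xi>(3) by (simp add: mult_ac)
  have "real n powr p \<le> x powr p" "x powr p \<le> (real n + 1) powr p"
    "real n powr p \<le> y powr p" "y powr p \<le> (real n + 1) powr p"
    using x y n p by (auto intro!: powr_mono2)
  then show ?thesis using d by linarith
qed

text \<open>
  With respect to \<open>dt / (1 - t)\<close> the \<open>n\<close>-th interval has measure at most \<open>4 c\<^sub>n\<close>, since \<open>1 - t\<close> is at least
  \<open>(1 - T\<^sub>n) / 2\<close> on it.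
\<close>
lemma nn_integral_union_near_points:
  fixes T c :: "nat \<Rightarrow> real"
  assumes T: "\<And>n. T n < 1" and c: "\<And>n. 0 \<le> c n" "\<And>n. c n \<le> 1/2" "summable c"
    and E: "E \<subseteq> (\<Union>n. {T n - c n * (1 - T n)..T n + c n * (1 - T n)})"
  shows "(\<integral>\<^sup>+t\<in>E. ennreal (1 / (1 - t)) \<partial>lebesgue) < \<infinity>"
proof -
  define J where "J n = {T n - c n * (1 - T n)..T n + c n * (1 - T n)}" for n
  have len: "emeasure lebesgue (J n) = ennreal (2 * c n * (1 - T n))" for n
    using c(1)[of n] T[of n] by (simp add: J_def)
  have le_suminf: "g n \<le> suminf g" for g :: "nat \<Rightarrow> ennreal" and n
    using sum_le_suminf[of g "{n}"] by simp
  have "(\<integral>\<^sup>+t\<in>E. ennreal (1 / (1 - t)) \<partial>lebesgue)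
      \<le> (\<integral>\<^sup>+t. (\<Sum>n. ennreal (2 / (1 - T n)) * indicator (J n) t) \<partial>lebesgue)"
  proof (rule nn_integral_mono)
    fix t
    show "ennreal (1 / (1 - t)) * indicator E t \<le> (\<Sum>n. ennreal (2 / (1 - T n)) * indicator (J n) t)"
    proof (cases "t \<in> E")
      case True
      then obtain n where n: "t \<in> J n" using E unfolding J_def by blast
      have "c n * (1 - T n) \<le> 1/2 * (1 - T n)" using c(2)[of n] T[of n] by (intro mult_right_mono) auto
      then have "1 - t \<ge> (1 - T n) / 2" using n by (simp add: J_def)
      then have "1 / (1 - t) \<le> 1 / ((1 - T n) / 2)"
        using T[of n] by (intro divide_left_mono mult_pos_pos) auto
      then have "ennreal (1 / (1 - t)) * indicator E t \<le> ennreal (2 / (1 - T n)) * indicator (J n) t"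
        using True n by (simp add: ennreal_leI)
      also have "\<dots> \<le> (\<Sum>n. ennreal (2 / (1 - T n)) * indicator (J n) t)"
        by (rule le_suminf)
      finally show ?thesis .
    qed simp
  qed
  also have "\<dots> = (\<Sum>n. (\<integral>\<^sup>+t. ennreal (2 / (1 - T n)) * indicator (J n) t \<partial>lebesgue))"
    by (intro nn_integral_suminf borel_measurable_times_ennreal borel_measurable_const
        borel_measurable_indicator) (simp add: J_def)
  also have "\<dots> = (\<Sum>n. ennreal (4 * c n))"
  proof (intro arg_cong[where f = suminf] ext)
    fix n
    have "(\<integral>\<^sup>+t. ennreal (2 / (1 - T n)) * indicator (J n) t \<partial>lebesgue)
        = ennreal (2 / (1 - T n)) * ennreal (2 * c n * (1 - T n))"
      by (subst nn_integral_cmult_indicator) (auto simp: J_def len[unfolded J_def])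
    also have "\<dots> = ennreal (4 * c n)"
      using T[of n] c(1)[of n] by (simp add: ennreal_mult'[symmetric])
    finally show "(\<integral>\<^sup>+t. ennreal (2 / (1 - T n)) * indicator (J n) t \<partial>lebesgue) = ennreal (4 * c n)" .
  qed
  also have "\<dots> = ennreal (\<Sum>n. 4 * c n)"
    using c by (intro suminf_ennreal2 summable_mult) auto
  also have "\<dots> < \<infinity>" by simp
  finally show ?thesis .
qed

text \<open>
  A growth lemma of Borel type. Let \<open>T\<^sub>n\<close> be the point where \<open>a powr \<beta>\<close> reaches \<open>n\<close>. If \<open>a(r) powr \<beta>\<close> is
  between \<open>n\<close> and \<open>n + 1\<close>, then \<open>16 \<epsilon>(r) \<le> d\<^sub>n (1 - r)\<close> with \<open>d\<^sub>n = 8 / (n (ln n) powr (1 + \<delta>))\<close>.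
  For large \<open>n\<close> the exceptional set contains all points of \<open>[r\<^sub>0, 1)\<close> up to distance
  \<open>2 d\<^sub>n (1 - T\<^sub>n\<^sub>+\<^sub>1)\<close> from \<open>T\<^sub>n\<^sub>+\<^sub>1\<close>. For any other \<open>r\<close> close to 1 the numbers \<open>s\<close> with \<open>|s - r| \<le> 16 \<epsilon>(r)\<close> therefore stay between \<open>T\<^sub>n\<close> and \<open>T\<^sub>n\<^sub>+\<^sub>1\<close>, so
  \<open>a(s) powr \<beta>\<close> is between \<open>n\<close> and \<open>n + 1\<close> as well.
\<close>
theorem slow_growth_outside_exceptional_set:
  fixes a \<epsilon> :: "real \<Rightarrow> real"
  assumes r0: "0 < r0" "r0 < 1"
    and mono: "\<And>r s. r0 \<le> r \<Longrightarrow> r \<le> s \<Longrightarrow> s < 1 \<Longrightarrow> a r \<le> a s"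
    and a_ge: "\<And>r. r0 \<le> r \<Longrightarrow> r < 1 \<Longrightarrow> a r \<ge> 2"
    and unb: "\<And>K. \<exists>r\<in>{r0..<1}. a r \<ge> K"
    and \<beta>: "0 < \<beta>" "\<beta> \<le> 1" and \<delta>: "0 < \<delta>"
    and \<epsilon>: "\<And>r. r0 \<le> r \<Longrightarrow> r < 1 \<Longrightarrow>
      \<epsilon> r \<le> (1 - r) / (2 * a r powr \<beta> * ln (a r) powr (1 + \<delta>))"
  obtains E C where "E \<subseteq> {r0..<1}" "E \<in> sets lebesgue"
    "(\<integral>\<^sup>+t\<in>E. ennreal (1 / (1 - t)) \<partial>lebesgue) < \<infinity>" "C > 0"
    "\<forall>\<^sub>F r in at 1 within ({r0..<1} - E). \<forall>s. \<bar>s - r\<bar> \<le> 16 * \<epsilon> r \<longrightarrow>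
       r0 \<le> s \<and> s < 1 \<and> \<bar>a s - a r\<bar> \<le> C * a r powr (1 - \<beta>)"
proof -
  define d where "d n = 8 * (1 / (real n * ln (real n) powr (1 + \<delta>)))" for n
  have sd: "summable d"
    using summable_inverse_ln_powr[OF \<delta>] unfolding d_def by (rule summable_mult)
  then have "\<forall>\<^sub>F n in sequentially. d n < 1/4"
    using summable_LIMSEQ_zero[OF sd] by (intro order_tendstoD) auto
  then have "\<forall>\<^sub>F n in sequentially. 2 \<le> n \<and> d n < 1/4"
    using eventually_ge_at_top[of 2] by eventually_elim auto
  then obtain n0 where n0: "\<And>n. n \<ge> n0 \<Longrightarrow> 2 \<le> n \<and> d n < 1/4"
    unfolding eventually_sequentially by blast
  have d0: "d n \<ge> 0" for n unfolding d_def by simp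
  have dmono: "d (Suc n) \<le> d n" if "n \<ge> 2" for n
  proof -
    have "ln (real n) > 0" using that by simp
    moreover have "ln (real n) \<le> ln (real (Suc n))" using that by simp
    ultimately have "ln (real n) powr (1 + \<delta>) \<le> ln (real (Suc n)) powr (1 + \<delta>)"
      using \<delta> by (intro powr_mono2) auto
    moreover have "ln (real n) powr (1 + \<delta>) > 0" using that by simp
    ultimately show ?thesis unfolding d_def
      using that by (intro mult_left_mono divide_left_mono mult_mono mult_pos_pos) auto
  qed
  define A where "A n = {s \<in> {r0..<1}. a s powr \<beta> \<ge> real n}" for n
  define T where "T n = Inf (A n)" for n
  have A_ne: "\<exists>s. s \<in> A n" for n
  proof -
    obtain s where s: "s \<in> {r0..<1}" "a s \<ge> (real n + 1) powr (1 / \<beta>)" using unb by blast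
    then have "((real n + 1) powr (1 / \<beta>)) powr \<beta> \<le> a s powr \<beta>"
      using \<beta> by (intro powr_mono2) auto
    then have "a s powr \<beta> \<ge> real n" using \<beta> by (simp add: powr_powr)
    then show ?thesis using s by (auto simp: A_def)
  qed
  have A_bdd: "bdd_below (A n)" for n by (auto simp: A_def bdd_below_def)
  have T1: "T n < 1" and T0: "T n \<ge> r0" and T_le: "s \<in> A n \<Longrightarrow> T n \<le> s" for n s
  proof -
    show le: "T n \<le> s" if "s \<in> A n" for s
      unfolding T_def using that A_bdd by (rule cInf_lower)
    obtain s where s: "s \<in> A n" using A_ne by blast
    then have "s < 1" by (simp add: A_def)
    then show "T n < 1" using le[OF s] by simp
    show "T n \<ge> r0" unfolding T_def using s by (intro cInf_greatest) (auto simp: A_def)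
  qed
  define J where "J n = {T (Suc n) - 2 * d n * (1 - T (Suc n))..T (Suc n) + 2 * d n * (1 - T (Suc n))}" for n
  define E where "E = {r0..<1} \<inter> (\<Union>n. J (n + n0))"
  define C where "C = (1 / \<beta>) * 2 powr (1 / \<beta> - 1)"
  have main: "r0 \<le> s \<and> s < 1 \<and> \<bar>a s - a r\<bar> \<le> C * a r powr (1 - \<beta>)"
    if r: "r \<in> {r0..<1} - E" and big: "a r powr \<beta> \<ge> real (Suc n0)" and s: "\<bar>s - r\<bar> \<le> 16 * \<epsilon> r" for r s
  proof -
    define n where "n = nat \<lfloor>a r powr \<beta>\<rfloor>"
    have n: "real n \<le> a r powr \<beta>" "a r powr \<beta> < real n + 1"
      unfolding n_def using big by linarith+
    have nn0: "n \<ge> Suc n0" unfolding n_def using big by linarith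
    obtain m where m: "n = Suc m" "m \<ge> n0" using nn0 by (cases n) auto
    have m2: "m \<ge> 2" "d m < 1/4" using n0[OF m(2)] by auto
    have dn: "d n < 1/4" using n0[of n] nn0 by auto
    have r01: "r0 \<le> r" "r < 1" using r by auto
    have ar: "a r \<ge> 2" using a_ge r01 by blast
    have Tr: "T n \<le> r" using n r01 by (intro T_le) (simp add: A_def)
    have rT: "r \<le> T (Suc n)" unfolding T_def
    proof (rule cInf_greatest)
      fix x assume x: "x \<in> A (Suc n)"
      show "r \<le> x"
      proof (rule ccontr)
        assume "\<not> r \<le> x"
        then have "a x \<le> a r" "a x \<ge> 0" using x r01 mono[of x r] a_ge[of x] by (auto simp: A_def)
        then have "a x powr \<beta> \<le> a r powr \<beta>" using \<beta> by (intro powr_mono2) auto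
        then show False using x n(2) by (simp add: A_def)
      qed
    qed (use A_ne in blast)
    have "r \<notin> J (k + n0)" for k using r unfolding E_def by blast
    from this[of "n - n0"] this[of "m - n0"] have "r \<notin> J n" "r \<notin> J m"
      using m by simp_all
    then have up: "T (Suc n) - r > 2 * d n * (1 - T (Suc n))"
      and lo: "r > T n + 2 * d m * (1 - T n)"
      using rT Tr d0[of n] d0[of m] T1[of "Suc n"] T1[of n] m
      by (auto simp: J_def not_le intro: order_trans)
    have "ln (real n) \<le> ln (a r powr \<beta>)" using n m2 m by (subst ln_le_cancel_iff) auto
    also have "\<dots> = \<beta> * ln (a r)" using ar by (simp add: ln_powr)
    also have "\<dots> \<le> 1 * ln (a r)" using \<beta> ar by (intro mult_right_mono) auto
    finally have "ln (real n) powr (1 + \<delta>) \<le> ln (a r) powr (1 + \<delta>)"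
      using m m2 \<delta> by (intro powr_mono2) auto
    then have den: "real n * ln (real n) powr (1 + \<delta>) \<le> a r powr \<beta> * ln (a r) powr (1 + \<delta>)"
      using n by (intro mult_mono) auto
    have denpos: "real n * ln (real n) powr (1 + \<delta>) > 0" using m m2 by auto
    define Q where "Q = a r powr \<beta> * ln (a r) powr (1 + \<delta>)"
    define Y where "Y = (1 - r) / Q"
    have "\<epsilon> r \<le> Y / 2" using \<epsilon>[OF r01] by (simp add: Q_def Y_def mult_ac)
    then have "16 * \<epsilon> r \<le> 8 * Y" by linarith
    then have "16 * \<epsilon> r \<le> 8 * ((1 - r) / Q)" unfolding Y_def .
    also have "\<dots> \<le> 8 * ((1 - r) / (real n * ln (real n) powr (1 + \<delta>)))"
      using den denpos r01 unfolding Q_def by (intro mult_left_mono frac_le) auto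
    also have "\<dots> = d n * (1 - r)" by (simp add: d_def)
    finally have step: "\<bar>s - r\<bar> \<le> d n * (1 - r)" using s by linarith
    have "d n * (1 - r) \<le> d m * (1 - T n)"
      using dmono[OF m2(1)] m Tr r01 d0 by (intro mult_mono) auto
    moreover have "d m * (1 - T n) \<ge> 0" using d0[of m] T1[of n] by simp
    ultimately have sT: "s > T n" using lo step by linarith
    \<comment> \<open>The factor 2 in \<open>J\<close> and \<open>d n < 1/4\<close> pass from \<open>1 - T (Suc n)\<close> to the larger \<open>1 - r\<close>.\<close>
    define x where "x = T (Suc n) - r"
    have x0: "x > 0"
    proof -
      have "2 * d n * (1 - T (Suc n)) \<ge> 0" using d0[of n] T1[of "Suc n"] by simp
      then show ?thesis using up by (simp add: x_def)
    qed
    have "d n * (1 - r) = d n * (1 - T (Suc n)) + d n * x" by (simp add: x_def algebra_simps)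
    also have "d n * (1 - T (Suc n)) < x / 2" using up by (simp add: x_def)
    also have "d n * x \<le> 1/4 * x" using dn x0 by (intro mult_right_mono) auto
    finally have "d n * (1 - r) < x" using x0 by simp
    then have sT': "s < T (Suc n)" using step by (simp add: x_def)
    have s01: "r0 \<le> s" "s < 1" using sT sT' T0[of n] T1[of "Suc n"] by auto
    have "\<exists>s'\<in>A n. s' < s"
      using sT A_ne[of n] unfolding T_def by (intro cInf_lessD) auto
    then obtain s' where s': "s' \<in> A n" "s' < s" by blast
    then have "a s' \<le> a s" "a s' \<ge> 0" using mono[of s' s] s01 a_ge[of s'] by (auto simp: A_def)
    then have "a s' powr \<beta> \<le> a s powr \<beta>" using \<beta> by (intro powr_mono2) auto
    then have sn: "real n \<le> a s powr \<beta>" using s' by (simp add: A_def)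
    have "s \<notin> A (Suc n)" using sT' T_le[of s "Suc n"] by auto
    then have sn': "a s powr \<beta> < real n + 1" using s01 by (simp add: A_def)
    have inv: "(a t powr \<beta>) powr (1 / \<beta>) = a t" if "a t \<ge> 2" for t
      using \<beta> that by (simp add: powr_powr)
    have "\<bar>(a s powr \<beta>) powr (1 / \<beta>) - (a r powr \<beta>) powr (1 / \<beta>)\<bar>
        \<le> (1 / \<beta>) * 2 powr (1 / \<beta> - 1) * (a r powr \<beta>) powr (1 / \<beta> - 1)"
      using \<beta> m sn sn' n by (intro powr_diff_le_consecutive[of n]) auto
    also have "(a r powr \<beta>) powr (1 / \<beta> - 1) = a r powr (1 - \<beta>)"
      using \<beta> by (simp add: powr_powr right_diff_distrib)
    finally have "\<bar>a s - a r\<bar> \<le> C * a r powr (1 - \<beta>)"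
      unfolding inv[OF ar] inv[OF a_ge[OF s01]] C_def .
    then show ?thesis using s01 by blast
  qed
  show ?thesis
  proof (rule that[of E C])
    show "E \<subseteq> {r0..<1}" by (auto simp: E_def)
    have "E \<in> sets borel" unfolding E_def J_def by measurable
    then show "E \<in> sets lebesgue" by (auto intro: sets_completionI_sets)
    show "(\<integral>\<^sup>+t\<in>E. ennreal (1 / (1 - t)) \<partial>lebesgue) < \<infinity>"
    proof (rule nn_integral_union_near_points[where T = "\<lambda>n. T (Suc (n + n0))" and c = "\<lambda>n. 2 * d (n + n0)"])
      show "summable (\<lambda>n. 2 * d (n + n0))"
        using sd by (intro summable_mult summable_ignore_initial_segment)
      show "2 * d (n + n0) \<le> 1/2" for n using n0[of "n + n0"] by simp
    qed (use T1 d0 in \<open>auto simp: E_def J_def\<close>)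
    show "C > 0" using \<beta> by (simp add: C_def)
    obtain r1 where r1: "r1 \<in> A (Suc n0)" using A_ne by blast
    have "\<forall>\<^sub>F r in at 1 within ({r0..<1} - E). r > r1"
      using r1 by (intro order_tendstoD(1)[OF tendsto_ident_at]) (auto simp: A_def)
    moreover have "\<forall>\<^sub>F r in at 1 within ({r0..<1} - E). r \<in> {r0..<1} - E"
      by (simp add: eventually_at_filter)
    ultimately show "\<forall>\<^sub>F r in at 1 within ({r0..<1} - E). \<forall>s. \<bar>s - r\<bar> \<le> 16 * \<epsilon> r \<longrightarrow>
       r0 \<le> s \<and> s < 1 \<and> \<bar>a s - a r\<bar> \<le> C * a r powr (1 - \<beta>)"
    proof eventually_elim
      case (elim r)
      have "a r1 \<le> a r" "a r1 \<ge> 0" using elim r1 mono[of r1 r] a_ge[of r1] by (auto simp: A_def)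
      then have "a r1 powr \<beta> \<le> a r powr \<beta>" using \<beta> by (intro powr_mono2) auto
      then have "a r powr \<beta> \<ge> real (Suc n0)" using r1 by (simp add: A_def)
      then show ?case using main[OF elim(2)] by blast
    qed
  qed
qed

section \<open>The disc about a maximum point\<close>

text \<open>
  The map \<open>u \<mapsto> u / (2 M - u)\<close> takes the half plane \<open>Re u < M\<close> into the unit disc and fixes 0, so the lemma of
  Schwarz applies to its composition with \<open>g\<close>.
\<close>
lemma Borel_Caratheodory_half_radius:
  assumes g: "g holomorphic_on ball w \<rho>" "g w = 0" and \<rho>: "\<rho> > 0"
    and M: "\<And>z. z \<in> ball w \<rho> \<Longrightarrow> Re (g z) < M"
    and z: "cmod (z - w) \<le> \<rho> / 2"
  shows "cmod (g z) \<le> 2 * M"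
proof -
  have M0: "M > 0" using M[of w] g(2) \<rho> by simp
  define h where "h \<zeta> = g (w + of_real \<rho> * \<zeta>)" for \<zeta>
  have inb: "w + of_real \<rho> * \<zeta> \<in> ball w \<rho>" if "cmod \<zeta> < 1" for \<zeta>
    using that \<rho> by (simp add: dist_norm norm_mult)
  have h: "h holomorphic_on ball 0 1" unfolding h_def
    using inb by (intro holomorphic_on_compose_gen[OF _ g(1), unfolded o_def] holomorphic_intros) auto
  have Reh: "Re (h \<zeta>) < M" if "cmod \<zeta> < 1" for \<zeta> unfolding h_def by (intro M inb that)
  have nz: "2 * of_real M - h \<zeta> \<noteq> 0" if "cmod \<zeta> < 1" for \<zeta>
    using Reh[OF that] M0 by (auto simp: complex_eq_iff)
  define \<psi> where "\<psi> \<zeta> = h \<zeta> / (2 * of_real M - h \<zeta>)" for \<zeta>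
  have \<psi>1: "cmod (\<psi> \<zeta>) < 1" if "cmod \<zeta> < 1" for \<zeta>
  proof -
    have "(cmod (h \<zeta>))\<^sup>2 < (cmod (2 * of_real M - h \<zeta>))\<^sup>2"
    proof -
      have "(cmod (2 * of_real M - h \<zeta>))\<^sup>2 - (cmod (h \<zeta>))\<^sup>2 = 4 * M * (M - Re (h \<zeta>))"
        unfolding cmod_power2 by (simp add: power2_eq_square algebra_simps)
      also have "\<dots> > 0" using M0 Reh[OF that] by simp
      finally show ?thesis by simp
    qed
    then have "cmod (h \<zeta>) < cmod (2 * of_real M - h \<zeta>)" by (rule power2_less_imp_less) simp
    then show ?thesis using nz[OF that] by (simp add: \<psi>_def norm_divide)
  qed
  define \<zeta> where "\<zeta> = (z - w) / of_real \<rho>"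
  have \<zeta>: "cmod \<zeta> \<le> 1/2" using z \<rho> by (simp add: \<zeta>_def norm_divide field_simps)
  have hz: "h \<zeta> = g z" using \<rho> by (simp add: h_def \<zeta>_def)
  have hol\<psi>: "\<psi> holomorphic_on ball 0 1" unfolding \<psi>_def
    using nz by (intro holomorphic_intros h) auto
  have "\<psi> 0 = 0" by (simp add: \<psi>_def h_def g(2))
  from Schwarz_Lemma(1)[OF hol\<psi> this \<psi>1] have "cmod (\<psi> \<zeta>) \<le> cmod \<zeta>"
    using \<zeta> by simp
  then have \<psi>2: "cmod (\<psi> \<zeta>) \<le> 1/2" using \<zeta> by simp
  have "g z = \<psi> \<zeta> * (2 * of_real M - g z)"
    using nz[of \<zeta>] \<zeta> by (simp add: \<psi>_def hz)
  then have "cmod (g z) = cmod (\<psi> \<zeta>) * cmod (2 * of_real M - g z)" by (metis norm_mult)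
  also have "\<dots> \<le> 1/2 * (2 * M + cmod (g z))"
    using \<psi>2 M0 norm_triangle_ineq4[of "2 * of_real M" "g z"] by (intro mult_mono) auto
  finally show ?thesis by simp
qed

lemma ln_diff_le_of_abs_diff:
  fixes r s m :: real
  assumes "0 < m" "m \<le> r" "m \<le> s"
  shows "\<bar>ln s - ln r\<bar> \<le> \<bar>s - r\<bar> / m"
proof -
  have *: "ln y - ln x \<le> (y - x) / m" if "m \<le> x" "x \<le> y" for x y
  proof -
    have "ln y - ln x = ln (y / x)" using that assms by (simp add: ln_div)
    also have "\<dots> \<le> y / x - 1" using that assms by (intro ln_le_minus_one) auto
    also have "\<dots> = (y - x) / x" using that assms by (simp add: field_simps)
    also have "\<dots> \<le> (y - x) / m" using that assms by (intro frac_le) auto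
    finally show ?thesis .
  qed
  show ?thesis
  proof (cases "r \<le> s")
    case True
    then have "ln r \<le> ln s" using assms by simp
    then show ?thesis using *[of r s] True assms by simp
  next
    case False
    then have "ln s \<le> ln r" using assms by simp
    then show ?thesis using *[of s r] False assms by simp
  qed
qed

context meromorphic_tract
begin

text \<open>
  The tangent to \<open>B\<close> at \<open>|z|\<close> lies below \<open>B\<close> at \<open>r\<close>, which bounds \<open>B(|z|)\<close> with the slope at \<open>|z|\<close>. Replacing
  it by the slope at \<open>r\<close> costs at most the variation \<open>D\<close> of \<open>a\<close>.
\<close>
lemma tract_fun_le_linear:
  assumes r: "0 < r0" "r0 \<le> r" "r < 1" and D: "D \<ge> 0"
    and z: "r0 \<le> cmod z" "cmod z < 1" "\<bar>a (cmod z) - a r\<bar> \<le> D"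
  shows "v z \<le> B r + a r * (ln (cmod z) - ln r) + D * (\<bar>cmod z - r\<bar> / r0)"
proof -
  define s where "s = cmod z"
  have s: "0 < s" "r0 \<le> s" "s < 1" using z r by (auto simp: s_def)
  have "v z \<le> B s" using tract_fun_le_circle_max[OF z(2)] by (simp add: s_def)
  also have "B s \<le> B r + a s * (ln s - ln r)"
    using circle_max_support[of s r] s r by (simp add: algebra_simps)
  also have "\<dots> = B r + a r * (ln s - ln r) + (a s - a r) * (ln s - ln r)"
    by (simp add: algebra_simps)
  also have "(a s - a r) * (ln s - ln r) \<le> D * (\<bar>s - r\<bar> / r0)"
  proof -
    have "(a s - a r) * (ln s - ln r) \<le> \<bar>a s - a r\<bar> * \<bar>ln s - ln r\<bar>"
      by (metis abs_ge_self abs_mult)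
    also have "\<dots> \<le> D * (\<bar>s - r\<bar> / r0)"
      using z(3) ln_diff_le_of_abs_diff[of r0 r s] r s D by (intro mult_mono) (auto simp: s_def)
    finally show ?thesis .
  qed
  finally show ?thesis by (simp add: s_def)
qed

text \<open>
  The increase of \<open>B\<close> from \<open>r - 16 \<kappa>\<close> to \<open>r\<close> at slope at least \<open>3/4 a(r)\<close> makes up for the decrease of the
  linear function on the shorter interval of length \<open>9 \<kappa>\<close>, since \<open>3/4 \<cdot> 16 = 12\<close> and \<open>ln r - ln s\<close> is at most
  \<open>9 \<kappa> / (3/4 r) = 12 \<kappa> / r\<close>.
\<close>
lemma linear_part_large:
  assumes r: "0 < r" "r < 1" and q: "q = r - 16 * \<kappa>" and \<kappa>: "0 < \<kappa>" "36 * \<kappa> \<le> r"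
    and aq: "a q \<ge> 3/4 * a r" "a r \<ge> 0" and s: "r - 9 * \<kappa> \<le> s"
  shows "B q \<le> B r + a r * (ln s - ln r)"
proof -
  have q0: "0 < q" "q < r" using q \<kappa> r by auto
  have lnq: "16 * \<kappa> / r \<le> ln r - ln q"
  proof -
    have "ln (q / r) \<le> q / r - 1" using q0 r by (intro ln_le_minus_one) auto
    then show ?thesis using q0 r by (simp add: ln_div q field_simps)
  qed
  have lns: "ln r - ln s \<le> 12 * \<kappa> / r"
  proof -
    define t where "t = r - 9 * \<kappa>"
    have t: "0 < t" "t \<le> s" "3/4 * r \<le> t" using \<kappa> r s by (auto simp: t_def)
    have "ln r - ln s \<le> ln r - ln t" using t by simp
    also have "\<dots> = ln (r / t)" using t r by (simp add: ln_div)
    also have "\<dots> \<le> r / t - 1" using t r by (intro ln_le_minus_one) auto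
    also have "\<dots> = 9 * \<kappa> / t" using t by (simp add: t_def field_simps)
    also have "\<dots> \<le> 9 * \<kappa> / (3/4 * r)" using t \<kappa> r by (intro frac_le) auto
    finally show ?thesis by simp
  qed
  have "a r * (ln r - ln s) \<le> a r * (12 * \<kappa> / r)"
    using lns aq(2) by (intro mult_left_mono) auto
  also have "\<dots> = 3/4 * a r * (16 * \<kappa> / r)" by simp
  also have "\<dots> \<le> a q * (ln r - ln q)"
    using aq lnq \<kappa> r by (intro mult_mono) auto
  finally have "a r * (ln r - ln s) \<le> a q * (ln r - ln q)" .
  moreover have "B r \<ge> B q + a q * (ln r - ln q)"
    using circle_max_support[of q r] q0 r by simp
  ultimately show ?thesis by (simp add: right_diff_distrib)
qed

text \<open>
  The numbers 9 and 36 are those of \<open>positive_on_disc_of_small_excess\<close>, applied on the disc of radius \<open>9 \<kappa>\<close>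
  about \<open>w\<close>, which gives that the disc \<open>\<D>\<close> of radius \<open>\<kappa>\<close> lies in \<open>U\<close>. On it \<open>f\<close> has a logarithm \<open>l\<close>, and
  \<open>\<gamma>\<close> is the value at \<open>z\<close> of \<open>g(y) = l(y) - l(w) - a(r) Ln (y / w)\<close>, whose real part is below \<open>\<eta>\<close>.
\<close>
theorem disc_about_maximum_point:
  assumes r0: "0 < r0" "r0 \<le> r" "r < 1" and w: "cmod w = r" "v w = B r"
    and \<kappa>: "0 < \<kappa>" "36 * \<kappa> \<le> r"
    and slow: "\<And>s. \<bar>s - r\<bar> \<le> 16 * \<kappa> \<Longrightarrow> r0 \<le> s \<and> s < 1 \<and> \<bar>a s - a r\<bar> \<le> D"
    and D: "0 \<le> D" "D \<le> a r / 4" and large: "B (r - 16 * \<kappa>) \<ge> 36"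
    and \<eta>: "9 * \<kappa> * D / r0 < \<eta>" "\<eta> < 1"
    and z: "cmod (z - w) \<le> \<kappa> / 4"
  obtains \<gamma> where "f z = f w * exp (of_real (a r) * Ln (z / w)) * exp \<gamma>" "cmod \<gamma> \<le> 2 * \<eta>"
    "cmod (deriv f z / f z - of_real (a r) / z) \<le> 8 * \<eta> / \<kappa>" "f w \<noteq> 0"
proof -
  have r: "0 < r" using r0 by simp
  have w0: "w \<noteq> 0" using w r by auto
  have ar: "a r \<ge> 0" using D by simp
  have near: "\<bar>cmod y - r\<bar> \<le> cmod (y - w)" for y
    using norm_triangle_ineq3[of y w] w by simp
  have slow9: "r0 \<le> cmod y" "cmod y < 1" "\<bar>a (cmod y) - a r\<bar> \<le> D" if "cmod (y - w) < 9 * \<kappa>" for y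
    using slow[of "cmod y"] near[of y] that \<kappa> by auto
  have Re_pos: "Re (y / w) > 0" if "cmod (y - w) < 9 * \<kappa>" for y
  proof -
    have "cmod (y / w - 1) < 1"
    proof -
      have "y / w - 1 = (y - w) / w" using w0 by (simp add: field_simps)
      then show ?thesis using that w \<kappa> r by (simp add: norm_divide)
    qed
    then show ?thesis using abs_Re_le_cmod[of "y / w - 1"] by simp
  qed
  have upper: "v y \<le> B r + a r * (ln (cmod y) - ln r) + \<eta>" if y: "cmod (y - w) < 9 * \<kappa>" for y
  proof -
    have "D * (\<bar>cmod y - r\<bar> / r0) \<le> D * (9 * \<kappa> / r0)"
      using near[of y] y D r0 by (intro mult_left_mono divide_right_mono) auto
    then show ?thesis
      using tract_fun_le_linear[OF r0 D(1) slow9[OF y]] \<eta>(1) by (simp add: mult_ac)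
  qed
  have lower: "B r + a r * (ln (cmod y) - ln r) \<ge> 36" if y: "cmod (y - w) < 9 * \<kappa>" for y
  proof -
    have "\<bar>a (r - 16 * \<kappa>) - a r\<bar> \<le> D" using slow[of "r - 16 * \<kappa>"] \<kappa> by simp
    then have "a (r - 16 * \<kappa>) \<ge> 3/4 * a r" using D(2) by linarith
    then show ?thesis
      using linear_part_large[OF r r0(3) refl \<kappa> _ ar, of "cmod y"] near[of y] y large by linarith
  qed
  have ReLn: "Re (Ln (y / w)) = ln (cmod y) - ln r" if "cmod (y - w) < 9 * \<kappa>" for y
  proof -
    have "y \<noteq> 0" using slow9(1)[OF that] r0 by auto
    then show ?thesis using w0 w r by (simp add: norm_divide ln_div)
  qed
  have UL: "y \<in> U" if y: "cmod (y - w) < \<kappa>" for y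
  proof -
    define m where "m \<zeta> = w + of_real \<kappa> * \<zeta>" for \<zeta> :: complex
    have m9: "cmod (m \<zeta> - w) < 9 * \<kappa>" if "\<zeta> \<in> ball 0 9" for \<zeta>
      using that \<kappa> by (simp add: m_def norm_mult)
    have m1: "m \<zeta> \<in> ball 0 1" if "\<zeta> \<in> ball 0 9" for \<zeta>
      using slow9[OF m9[OF that]] by simp
    have holm: "m holomorphic_on A" for A unfolding m_def by (intro holomorphic_intros)
    have "v (m ((y - w) / of_real \<kappa>)) > 0"
    proof (rule positive_on_disc_of_small_excess[where V = "\<lambda>\<zeta>. v (m \<zeta>)" and F = "\<lambda>\<zeta>. f (m \<zeta>) / of_real R"
          and G = "\<lambda>\<zeta>. of_real (B r) + of_real (a r) * Ln (m \<zeta> / w)" and \<eta> = \<eta>])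
      show "continuous_on (ball 0 9) (\<lambda>\<zeta>. v (m \<zeta>))"
        by (rule continuous_on_compose2[OF continuous_tract_fun holomorphic_on_imp_continuous_on[OF holm]])
           (use m1 in auto)
      show "harmonically_supported (\<lambda>\<zeta>. v (m \<zeta>)) (ball 0 9)"
        by (rule harmonically_supported_compose[OF harmonically_supported_tract_fun _ holm]) (use m1 in auto)
      have "(f \<circ> m) holomorphic_on {\<zeta> \<in> ball 0 9. v (m \<zeta>) > 0}"
        by (rule holomorphic_on_compose_gen[OF holm holomorphic_U]) (auto simp: tract_fun_pos_iff)
      then show "(\<lambda>\<zeta>. f (m \<zeta>) / of_real R) holomorphic_on {\<zeta> \<in> ball 0 9. v (m \<zeta>) > 0}"
        using R_pos by (intro holomorphic_intros) (auto simp: o_def)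
      show "f (m \<zeta>) / of_real R \<noteq> 0 \<and> v (m \<zeta>) = ln (cmod (f (m \<zeta>) / of_real R))"
        if "v (m \<zeta>) > 0" for \<zeta>
        using that large_on_U[of "m \<zeta>"] tract_fun_eq[of "m \<zeta>"] R_pos
        by (auto simp: tract_fun_pos_iff)
      have "m \<zeta> / w \<notin> \<real>\<^sub>\<le>\<^sub>0" if "\<zeta> \<in> ball 0 9" for \<zeta>
        using Re_pos[OF m9[OF that]] by (auto simp: complex_nonpos_Reals_iff)
      then show "(\<lambda>\<zeta>. of_real (B r) + of_real (a r) * Ln (m \<zeta> / w)) holomorphic_on ball 0 9"
        using w0 by (intro holomorphic_intros holm) auto
      show "v (m \<zeta>) \<le> Re (of_real (B r) + of_real (a r) * Ln (m \<zeta> / w)) + \<eta>"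
        "36 \<le> Re (of_real (B r) + of_real (a r) * Ln (m \<zeta> / w)) + \<eta>" if "\<zeta> \<in> ball 0 9" for \<zeta>
      proof -
        have "0 \<le> 9 * \<kappa> * D / r0" using \<kappa> D r0 by simp
        then have "0 \<le> \<eta>" using \<eta> by linarith
        then show "v (m \<zeta>) \<le> Re (of_real (B r) + of_real (a r) * Ln (m \<zeta> / w)) + \<eta>"
          "36 \<le> Re (of_real (B r) + of_real (a r) * Ln (m \<zeta> / w)) + \<eta>"
          using upper[OF m9[OF that]] lower[OF m9[OF that]] ReLn[OF m9[OF that]] by simp_all
      qed
      show "cmod ((y - w) / of_real \<kappa>) < 1" using y \<kappa> by (simp add: norm_divide)
    qed (use w w0 \<eta> tract_fun_nonneg in \<open>simp_all add: m_def\<close>)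
    then show ?thesis using \<kappa> by (simp add: m_def tract_fun_pos_iff)
  qed
  define \<D> where "\<D> = ball w \<kappa>"
  have \<D>U: "\<D> \<subseteq> U" using UL by (auto simp: \<D>_def dist_norm norm_minus_commute)
  have \<D>9: "cmod (y - w) < 9 * \<kappa>" if "y \<in> \<D>" for y
    using that \<kappa> by (auto simp: \<D>_def dist_norm norm_minus_commute)
  have wD: "w \<in> \<D>" using \<kappa> by (simp add: \<D>_def)
  have f0: "f y \<noteq> 0" if "y \<in> \<D>" for y using large_on_U[of y] \<D>U that R_pos by auto
  have fD: "f holomorphic_on \<D>" using holomorphic_U \<D>U holomorphic_on_subset by blast
  then obtain l where l: "l holomorphic_on \<D>" "\<And>y. y \<in> \<D> \<Longrightarrow> f y = exp (l y)"
    using contractible_imp_holomorphic_log[of f \<D>] f0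
    by (metis \<D>_def convex_ball convex_imp_contractible)
  define g where "g y = l y - l w - of_real (a r) * Ln (y / w)" for y
  have Lnn: "y / w \<notin> \<real>\<^sub>\<le>\<^sub>0" if "y \<in> \<D>" for y
    using Re_pos[OF \<D>9[OF that]] by (auto simp: complex_nonpos_Reals_iff)
  have g: "g holomorphic_on \<D>" unfolding g_def
    using Lnn w0 by (intro holomorphic_intros l) auto
  have gw: "g w = 0" using w0 by (simp add: g_def)
  have Reg: "Re (g y) < \<eta>" if y: "y \<in> \<D>" for y
  proof -
    have Rel: "Re (l x) = v x + ln R" if "x \<in> \<D>" for x
    proof -
      have xU: "x \<in> U" using that \<D>U by blast
      have "Re (l x) = ln (cmod (f x))" using l(2)[OF that] by simp
      then show ?thesis using tract_fun_eq[OF xU] f0[OF that] R_pos by (simp add: norm_divide ln_div)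
    qed
    have le: "v y \<le> B r + a r * (ln (cmod y) - ln r) + D * (\<bar>cmod y - r\<bar> / r0)"
      by (rule tract_fun_le_linear[OF r0 D(1) slow9[OF \<D>9[OF y]]])
    have "D * (\<bar>cmod y - r\<bar> / r0) \<le> D * (9 * \<kappa> / r0)"
      using near[of y] \<D>9[OF y] D r0 by (intro mult_left_mono divide_right_mono) auto
    then have "D * (\<bar>cmod y - r\<bar> / r0) < \<eta>" using \<eta>(1) by (simp add: mult_ac)
    then show ?thesis
      using le Rel[OF y] Rel[OF wD] ReLn[OF \<D>9[OF y]] w by (simp add: g_def)
  qed
  have gbd: "cmod (g y) \<le> 2 * \<eta>" if "cmod (y - w) \<le> \<kappa> / 2" for y
    by (rule Borel_Caratheodory_half_radius[OF g[unfolded \<D>_def] gw \<kappa>(1) Reg[unfolded \<D>_def] that])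
  have zD: "z \<in> \<D>" using z \<kappa> by (simp add: \<D>_def dist_norm norm_minus_commute)
  have sub: "cball z (\<kappa> / 4) \<subseteq> \<D>" and sub2: "\<And>y. y \<in> cball z (\<kappa> / 4) \<Longrightarrow> cmod (y - w) \<le> \<kappa> / 2"
  proof -
    show *: "cmod (y - w) \<le> \<kappa> / 2" if "y \<in> cball z (\<kappa> / 4)" for y
      using norm_triangle_ineq[of "y - z" "z - w"] z that by (simp add: dist_norm norm_minus_commute)
    show "cball z (\<kappa> / 4) \<subseteq> \<D>"
      using * \<kappa> by (fastforce simp: \<D>_def dist_norm norm_minus_commute)
  qed
  have "cmod ((deriv ^^ 1) g z) \<le> fact 1 * (2 * \<eta>) / (\<kappa> / 4) ^ 1"
  proof (rule Cauchy_inequality)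
    show "g holomorphic_on ball z (\<kappa> / 4)"
      by (rule holomorphic_on_subset[OF g]) (use sub in auto)
    show "continuous_on (cball z (\<kappa> / 4)) g"
      by (rule holomorphic_on_imp_continuous_on[OF holomorphic_on_subset[OF g sub]])
    show "cmod (g y) \<le> 2 * \<eta>" if "cmod (z - y) = \<kappa> / 4" for y
      using that by (intro gbd sub2) (simp add: dist_norm)
  qed (use \<kappa> in simp)
  then have dg: "cmod (deriv g z) \<le> 8 * \<eta> / \<kappa>" by simp
  have oD: "open \<D>" by (simp add: \<D>_def)
  have "(l has_field_derivative deriv l z) (at z)" using holomorphic_derivI[OF l(1) oD zD] .
  then have "((\<lambda>y. exp (l y)) has_field_derivative exp (l z) * deriv l z) (at z)"
    by (auto intro!: derivative_eq_intros)
  moreover have "\<forall>\<^sub>F y in nhds z. f y = exp (l y)"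
    using eventually_nhds_in_open[OF oD zD] by eventually_elim (rule l(2))
  ultimately have "(f has_field_derivative exp (l z) * deriv l z) (at z)"
    by (rule DERIV_cong_ev[OF refl _ refl, THEN iffD2, rotated])
  then have dl: "deriv l z = deriv f z / f z"
    using l(2)[OF zD] f0[OF zD] by (simp add: DERIV_imp_deriv)
  have z0: "z \<noteq> 0" using slow9(1)[OF \<D>9[OF zD]] r0 by auto
  have "(g has_field_derivative deriv l z - of_real (a r) * (inverse (z / w) * (1 / w))) (at z)"
    unfolding g_def using holomorphic_derivI[OF l(1) oD zD] Lnn[OF zD] w0
    by (auto intro!: derivative_eq_intros)
  then have "deriv g z = deriv f z / f z - of_real (a r) / z"
    using dl w0 z0 by (simp add: DERIV_imp_deriv field_simps)
  then have "cmod (deriv f z / f z - of_real (a r) / z) \<le> 8 * \<eta> / \<kappa>" using dg by simp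
  moreover have "f z = f w * exp (of_real (a r) * Ln (z / w)) * exp (g z)"
    using l(2)[OF zD] l(2)[OF wD] by (simp add: g_def flip: exp_add)
  moreover have "cmod (g z) \<le> 2 * \<eta>" using z \<kappa> by (intro gbd) simp
  ultimately show ?thesis using that f0[OF wD] by blast
qed

end

section \<open>The asymptotic relations\<close>

context meromorphic_tract
begin

lemma tract_eps_bounds:
  assumes \<beta>: "0 < \<beta>" "\<beta> \<le> 1" and \<delta>: "0 < \<delta>" and r: "r < 1" and a: "a r \<ge> exp 1"
  shows "0 < tract_eps v \<beta> \<delta> r" "tract_eps v \<beta> \<delta> r \<le> (1 - r) / 2"
    "tract_eps v \<beta> \<delta> r * a r powr (1 - \<beta>) \<le> ln (a r) powr (- (1 + \<delta>))"
proof -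
  have a1: "1 < a r" using a exp_ge_add_one_self[of "1::real"] by linarith
  have "ln (exp 1) \<le> ln (a r)" using a a1 by (subst ln_le_cancel_iff) auto
  then have ln1: "1 \<le> ln (a r)" by simp
  define P where "P = a r powr \<beta>"
  define L where "L = ln (a r) powr (1 + \<delta>)"
  have P: "1 \<le> P" using a1 \<beta> by (simp add: P_def ge_one_powr_ge_zero)
  have L: "1 \<le> L" using ln1 \<delta> by (simp add: L_def ge_one_powr_ge_zero)
  have Q: "0 < a r powr (1 - \<beta>)" using a1 by simp
  have "1 * 1 \<le> P * L" using P L by (intro mult_mono) auto
  then have PL: "2 \<le> 2 * P * L" by simp
  show "0 < tract_eps v \<beta> \<delta> r"
    using r P L Q unfolding tract_eps_def P_def[symmetric] L_def[symmetric] by simp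
  have "tract_eps v \<beta> \<delta> r \<le> (1 - r) / (2 * P * L)"
    unfolding tract_eps_def P_def L_def by (rule min.cobounded1)
  also have "\<dots> \<le> (1 - r) / 2" using PL r by (intro frac_le) auto
  finally show "tract_eps v \<beta> \<delta> r \<le> (1 - r) / 2" .
  have "tract_eps v \<beta> \<delta> r * a r powr (1 - \<beta>) \<le> 1 / (a r powr (1 - \<beta>) * L) * a r powr (1 - \<beta>)"
    using Q unfolding tract_eps_def L_def by (intro mult_right_mono min.cobounded2) auto
  also have "\<dots> = 1 / L" using Q by simp
  also have "\<dots> = ln (a r) powr (- (1 + \<delta>))" unfolding L_def powr_minus_divide ..
  finally show "tract_eps v \<beta> \<delta> r * a r powr (1 - \<beta>) \<le> ln (a r) powr (- (1 + \<delta>))" .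
qed

lemma log_slope_filterlim:
  assumes r0: "0 < r0" "r0 < 1"
  shows "filterlim a at_top (at 1 within ({r0..<1} - E))"
  unfolding filterlim_at_top
proof
  fix K
  obtain r1 where r1: "r1 \<in> {r0..<1}" "a r1 \<ge> K" using log_slope_unbounded[OF r0] by blast
  have "\<forall>\<^sub>F r in at 1 within ({r0..<1} - E). r > r1"
    using r1 by (intro order_tendstoD(1)[OF tendsto_ident_at]) auto
  moreover have "\<forall>\<^sub>F r in at 1 within ({r0..<1} - E). r \<in> {r0..<1} - E"
    by (simp add: eventually_at_filter)
  ultimately show "\<forall>\<^sub>F r in at 1 within ({r0..<1} - E). K \<le> a r"
  proof eventually_elim
    case (elim r)
    then show ?case using log_slope_mono[of r1 r] r1 r0 by auto
  qed
qed

text \<open>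
  Outside the exceptional set take \<open>\<kappa> = \<epsilon>(r)\<close>, \<open>D = C a(r) powr (1 - \<beta>)\<close> and \<open>\<eta> = 10 \<kappa> D / r\<^sub>0\<close>. The second
  term in the definition of \<open>\<epsilon>\<close> gives \<open>\<eta> = O(ln (a(r)) powr - (1 + \<delta>))\<close>, and
  \<open>\<eta> / (\<kappa> a(r)) = O(a(r) powr - \<beta>)\<close> whatever \<open>\<kappa>\<close> is. Both tend to 0 because \<open>a\<close> tends to infinity.
\<close>
theorem asymptotics_outside_exceptional_set:
  assumes r0: "0 < r0" "r0 < 1"
    and a_ge: "\<And>r. r0 \<le> r \<Longrightarrow> r < 1 \<Longrightarrow> a r \<ge> 2"
    and \<beta>: "0 < \<beta>" "\<beta> \<le> 1" and \<delta>: "0 < \<delta>"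
  obtains E where "E \<subseteq> {r0..<1}" "E \<in> sets lebesgue"
    "(\<integral>\<^sup>+t\<in>E. ennreal (1 / (1 - t)) \<partial>lebesgue) < \<infinity>"
    "\<And>e. e > 0 \<Longrightarrow> \<forall>\<^sub>F r in at 1 within ({r0..<1} - E). \<forall>w z. (w, z) \<in> admissible_pairs v \<beta> \<delta> r \<longrightarrow>
       w \<noteq> 0 \<and> z \<noteq> 0 \<and>
       cmod (f z / (f w * exp (of_real (a r) * Ln (z / w))) - 1) < e \<and>
       cmod (deriv f z / f z / (of_real (a r) / z) - 1) < e"
proof -
  define \<epsilon> where "\<epsilon> = tract_eps v \<beta> \<delta>"
  have mono: "a r \<le> a s" if "r0 \<le> r" "r \<le> s" "s < 1" for r s
    using log_slope_mono[of r s] that r0 by simp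
  have eps: "\<epsilon> r \<le> (1 - r) / (2 * a r powr \<beta> * ln (a r) powr (1 + \<delta>))" for r
    unfolding \<epsilon>_def tract_eps_def by (rule min.cobounded1)
  obtain E C where E: "E \<subseteq> {r0..<1}" "E \<in> sets lebesgue"
    "(\<integral>\<^sup>+t\<in>E. ennreal (1 / (1 - t)) \<partial>lebesgue) < \<infinity>" and C: "C > 0"
    and slow: "\<forall>\<^sub>F r in at 1 within ({r0..<1} - E). \<forall>s. \<bar>s - r\<bar> \<le> 16 * \<epsilon> r \<longrightarrow>
       r0 \<le> s \<and> s < 1 \<and> \<bar>a s - a r\<bar> \<le> C * a r powr (1 - \<beta>)"
    by (rule slow_growth_outside_exceptional_set[OF r0 mono a_ge log_slope_unbounded[OF r0] \<beta> \<delta> eps])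
  obtain r1 where r1: "r1 < 1" "\<And>r. r1 \<le> r \<Longrightarrow> r < 1 \<Longrightarrow> B r \<ge> 36"
  proof -
    have "a r \<ge> 0" if "r0 \<le> r" "r < 1" for r using a_ge[OF that] by simp
    then show ?thesis using circle_max_eventually_ge[OF r0, of 36] that by auto
  qed
  show ?thesis
  proof (rule that[OF E])
    fix e :: real assume e: "e > 0"
    let ?F = "at 1 within ({r0..<1} - E)"
    have c\<beta>: "((\<lambda>x. c * x powr (- \<beta>)) \<longlongrightarrow> 0) at_top" for c :: real
      using \<beta> by real_asymp
    have c\<delta>: "((\<lambda>x. c * ln x powr (- (1 + \<delta>))) \<longlongrightarrow> 0) at_top" for c :: real
      using \<delta> by real_asymp
    have "\<forall>\<^sub>F x in at_top. C * x powr (- \<beta>) < 1/4"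
      "\<forall>\<^sub>F x in at_top. (80 * C / r0) * x powr (- \<beta>) < e"
      "\<forall>\<^sub>F x in at_top. (10 * C / r0) * ln x powr (- (1 + \<delta>)) < min (1/4) (e/3)"
      using e by (intro order_tendstoD(2)[OF c\<beta>] order_tendstoD(2)[OF c\<delta>]; simp)+
    then have "\<forall>\<^sub>F x in at_top. x \<ge> exp 1 \<and> C * x powr (- \<beta>) < 1/4 \<and> (80 * C / r0) * x powr (- \<beta>) < e \<and>
        (10 * C / r0) * ln x powr (- (1 + \<delta>)) < min (1/4) (e/3)"
      using eventually_ge_at_top[of "exp (1::real)"] by eventually_elim auto
    then have "\<forall>\<^sub>F r in ?F. a r \<ge> exp 1 \<and> C * a r powr (- \<beta>) < 1/4 \<and> (80 * C / r0) * a r powr (- \<beta>) < e \<and>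
        (10 * C / r0) * ln (a r) powr (- (1 + \<delta>)) < min (1/4) (e/3)"
      by (rule eventually_compose_filterlim[OF _ log_slope_filterlim[OF r0]])
    moreover have "\<forall>\<^sub>F r in ?F. r > max (18/19) ((r1 + 8) / 9)"
      using r1(1) by (intro order_tendstoD(1)[OF tendsto_ident_at]) auto
    moreover have "\<forall>\<^sub>F r in ?F. r \<in> {r0..<1} - E"
      by (simp add: eventually_at_filter)
    ultimately show "\<forall>\<^sub>F r in ?F. \<forall>w z. (w, z) \<in> admissible_pairs v \<beta> \<delta> r \<longrightarrow>
       w \<noteq> 0 \<and> z \<noteq> 0 \<and>
       cmod (f z / (f w * exp (of_real (a r) * Ln (z / w))) - 1) < e \<and>
       cmod (deriv f z / f z / (of_real (a r) / z) - 1) < e"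
      using slow
    proof eventually_elim
      case (elim r)
      show ?case
      proof (intro allI impI)
        fix w z assume adm: "(w, z) \<in> admissible_pairs v \<beta> \<delta> r"
        have r: "r0 \<le> r" "r < 1" "0 < r" "18/19 < r" "(r1 + 8) / 9 < r" using elim r0 by auto
        have ar: "a r \<ge> exp 1" "a r > 0" using elim a_ge[OF r(1,2)] by auto
        have small: "C * a r powr (- \<beta>) < 1/4" "(80 * C / r0) * a r powr (- \<beta>) < e"
          "(10 * C / r0) * ln (a r) powr (- (1 + \<delta>)) < min (1/4) (e/3)" using elim by auto
        have sl: "r0 \<le> s \<and> s < 1 \<and> \<bar>a s - a r\<bar> \<le> C * a r powr (1 - \<beta>)" if "\<bar>s - r\<bar> \<le> 16 * \<epsilon> r" for s
          using elim(4) that by blast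
        define D where "D = C * a r powr (1 - \<beta>)"
        have \<epsilon>: "0 < \<epsilon> r" "\<epsilon> r \<le> (1 - r) / 2" "\<epsilon> r * a r powr (1 - \<beta>) \<le> ln (a r) powr (- (1 + \<delta>))"
          using tract_eps_bounds[OF \<beta> \<delta> r(2) ar(1)] by (auto simp: \<epsilon>_def)
        have Da: "D = C * a r powr (- \<beta>) * a r"
          using ar by (simp add: D_def powr_diff powr_minus_divide)
        have D: "0 < D" "D \<le> a r / 4"
        proof -
          show "0 < D" using C ar by (simp add: D_def)
          have "C * a r powr (- \<beta>) * a r \<le> 1/4 * a r" using small ar by (intro mult_right_mono) auto
          then show "D \<le> a r / 4" unfolding Da by simp
        qed
        define \<eta> where "\<eta> = 10 * \<epsilon> r * D / r0"
        have \<eta>0: "9 * \<epsilon> r * D / r0 < \<eta>" using \<epsilon>(1) D r0 by (simp add: \<eta>_def divide_strict_right_mono)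
        have "\<eta> = (10 * C / r0) * (\<epsilon> r * a r powr (1 - \<beta>))" by (simp add: \<eta>_def D_def)
        also have "\<dots> \<le> (10 * C / r0) * ln (a r) powr (- (1 + \<delta>))"
          using \<epsilon>(3) C r0 by (intro mult_left_mono) auto
        finally have \<eta>: "\<eta> < 1/4" "\<eta> < e / 3" using small(3) by auto
        have wz: "cmod w = r" "v w = B r" "cmod (z - w) \<le> \<epsilon> r / 4"
          using adm \<epsilon>(1) by (auto simp: admissible_pairs_def \<epsilon>_def)
        have "36 * \<epsilon> r \<le> 18 * (1 - r)" using \<epsilon>(2) by simp
        moreover have "18 * (1 - r) \<le> r" using r(4) by simp
        ultimately have k36: "36 * \<epsilon> r \<le> r" by linarith
        have B36: "B (r - 16 * \<epsilon> r) \<ge> 36"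
        proof (rule r1(2))
          have "r1 + 8 < 9 * r" using r(5) by simp
          then show "r1 \<le> r - 16 * \<epsilon> r" using \<epsilon>(2) by simp
          show "r - 16 * \<epsilon> r < 1" using \<epsilon>(1) r(2) by linarith
        qed
        have \<eta>1: "\<eta> < 1" using \<eta>(1) by simp
        obtain \<gamma> where \<gamma>: "f z = f w * exp (of_real (a r) * Ln (z / w)) * exp \<gamma>" "cmod \<gamma> \<le> 2 * \<eta>"
          "cmod (deriv f z / f z - of_real (a r) / z) \<le> 8 * \<eta> / \<epsilon> r" "f w \<noteq> 0"
          by (rule disc_about_maximum_point[OF r0(1) r(1,2) wz(1,2) \<epsilon>(1) k36 sl[folded D_def]
                less_imp_le[OF D(1)] D(2) B36 \<eta>0 \<eta>1 wz(3)])
        have z: "r0 \<le> cmod z" "cmod z < 1"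
        proof -
          have "\<bar>cmod z - r\<bar> \<le> 16 * \<epsilon> r" using norm_triangle_ineq3[of z w] wz \<epsilon>(1) by simp
          then show "r0 \<le> cmod z" "cmod z < 1" using sl by auto
        qed
        have nz: "w \<noteq> 0" "z \<noteq> 0" using wz(1) r z r0 by auto
        have "f z / (f w * exp (of_real (a r) * Ln (z / w))) = exp \<gamma>"
          using \<gamma>(1,4) by simp
        moreover have "cmod (exp \<gamma> - 1) \<le> 3 / 2 * cmod \<gamma>"
          using \<gamma>(2) \<eta>(1) by (intro norm_exp_bounds) auto
        ultimately have 1: "cmod (f z / (f w * exp (of_real (a r) * Ln (z / w))) - 1) < e"
          using \<gamma>(2) \<eta>(2) by auto
        have "deriv f z / f z / (of_real (a r) / z) - 1
            = (deriv f z / f z - of_real (a r) / z) * (z / of_real (a r))"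
          using ar nz by (simp add: field_simps)
        then have "cmod (deriv f z / f z / (of_real (a r) / z) - 1)
            = cmod (deriv f z / f z - of_real (a r) / z) * (cmod z / a r)"
          using ar by (simp add: norm_mult norm_divide)
        also have "\<dots> \<le> (8 * \<eta> / \<epsilon> r) * (1 / a r)"
          using \<gamma>(3) z ar by (intro mult_mono divide_right_mono) (auto intro: order_trans[OF norm_ge_zero])
        also have "\<dots> = (80 * C / r0) * a r powr (- \<beta>)"
          using \<epsilon>(1) ar r0 by (simp add: \<eta>_def Da)
        also have "\<dots> < e" by (rule small(2))
        finally show "w \<noteq> 0 \<and> z \<noteq> 0 \<and>
           cmod (f z / (f w * exp (of_real (a r) * Ln (z / w))) - 1) < e \<and>
           cmod (deriv f z / f z / (of_real (a r) / z) - 1) < e"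
          using 1 nz by blast
      qed
    qed
  qed
qed

end

theorem theorem1p1:
  fixes f :: "complex \<Rightarrow> complex" and U :: "complex set" and R r0 \<beta> \<delta> :: real
    and v :: "complex \<Rightarrow> real" and B a :: "real \<Rightarrow> real"
  defines "v \<equiv> tract_fun f R U"
  defines "B \<equiv> circle_max v"
  defines "a \<equiv> log_slope v"
  assumes mero: "f nicely_meromorphic_on ball 0 1"
    and tract: "direct_tract f R U"
    and r0: "0 < r0" "r0 < 1"
    and B_ge: "\<And>r. r0 \<le> r \<Longrightarrow> r < 1 \<Longrightarrow> B r \<ge> 2"
    and a_ge: "\<And>r. r0 \<le> r \<Longrightarrow> r < 1 \<Longrightarrow> a r \<ge> 2"
    and beta: "0 < \<beta>" "\<beta> \<le> 1 / 2"
    and delta: "0 < \<delta>"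
  shows "\<exists>E. E \<subseteq> {r0..<1} \<and> E \<in> sets lebesgue \<and>
           (\<integral>\<^sup>+t\<in>E. ennreal (1 / (1 - t)) \<partial>lebesgue) < \<infinity> \<and>
           uniformly_asymp_equiv (at 1 within ({r0..<1} - E)) (admissible_pairs v \<beta> \<delta>)
             (\<lambda>r (w, z). f z) (\<lambda>r (w, z). f w * (z / w) powr of_real (a r)) \<and>
           uniformly_asymp_equiv (at 1 within ({r0..<1} - E)) (admissible_pairs v \<beta> \<delta>)
             (\<lambda>r (w, z). f z) (\<lambda>r (w, z). f w * exp (of_real (a r) * Ln (z / w))) \<and>
           uniformly_asymp_equiv (at 1 within ({r0..<1} - E)) (admissible_pairs v \<beta> \<delta>)
             (\<lambda>r (w, z). deriv f z / f z) (\<lambda>r (w, z). of_real (a r) / z)"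
proof -
  interpret T: meromorphic_tract f R U by unfold_locales (fact mero tract)+
  have \<beta>1: "\<beta> \<le> 1" using beta by simp
  have ge: "T.a r \<ge> 2" if "r0 \<le> r" "r < 1" for r
    using a_ge[OF that] unfolding a_def v_def .
  have powr_exp: "(z / w) powr of_real (a r) = exp (of_real (a r) * Ln (z / w))"
    if "w \<noteq> 0" "z \<noteq> 0" for w z :: complex and r using that by (simp add: powr_def)
  show ?thesis
  proof (rule T.asymptotics_outside_exceptional_set[OF r0 ge beta(1) \<beta>1 delta])
    fix E assume E: "E \<subseteq> {r0..<1}" "E \<in> sets lebesgue"
      "(\<integral>\<^sup>+t\<in>E. ennreal (1 / (1 - t)) \<partial>lebesgue) < \<infinity>"
      and *: "\<And>e. e > 0 \<Longrightarrow> \<forall>\<^sub>F r in at 1 within ({r0..<1} - E).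
        \<forall>w z. (w, z) \<in> admissible_pairs T.v \<beta> \<delta> r \<longrightarrow> w \<noteq> 0 \<and> z \<noteq> 0 \<and>
          cmod (f z / (f w * exp (of_real (T.a r) * Ln (z / w))) - 1) < e \<and>
          cmod (deriv f z / f z / (of_real (T.a r) / z) - 1) < e"
    have asymp: "\<forall>\<^sub>F r in at 1 within ({r0..<1} - E).
        \<forall>w z. (w, z) \<in> admissible_pairs v \<beta> \<delta> r \<longrightarrow> w \<noteq> 0 \<and> z \<noteq> 0 \<and>
          cmod (f z / (f w * exp (of_real (a r) * Ln (z / w))) - 1) < e \<and>
          cmod (deriv f z / f z / (of_real (a r) / z) - 1) < e" if "e > 0" for e
      using *[OF that] unfolding a_def v_def .
    have uniform: "uniformly_asymp_equiv (at 1 within ({r0..<1} - E)) (admissible_pairs v \<beta> \<delta>) X Y"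
      if "\<And>r e. \<forall>w z. (w, z) \<in> admissible_pairs v \<beta> \<delta> r \<longrightarrow> w \<noteq> 0 \<and> z \<noteq> 0 \<and>
          cmod (f z / (f w * exp (of_real (a r) * Ln (z / w))) - 1) < e \<and>
          cmod (deriv f z / f z / (of_real (a r) / z) - 1) < e \<Longrightarrow>
          \<forall>p\<in>admissible_pairs v \<beta> \<delta> r. cmod (X r p / Y r p - 1) < e" for X Y
      unfolding uniformly_asymp_equiv_def
    proof (intro allI impI)
      fix e :: real assume "e > 0"
      from asymp[OF this] show "\<forall>\<^sub>F r in at 1 within ({r0..<1} - E).
          \<forall>p\<in>admissible_pairs v \<beta> \<delta> r. cmod (X r p / Y r p - 1) < e"
        by (rule eventually_mono) (rule that)
    qed
    show ?thesis
      by (intro exI[of _ E] conjI E uniform) (auto simp: powr_exp)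
  qed
qed

end
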